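(* For any Coxeter group $G$ and multiplicity function $m$, any $m$-harmonic polynomial is $m$-quasiinvariant: $H_m\subset Q_m$.
   Context: $V$ is a Euclidean space of dimension $n$ with inner product $(\cdot,\cdot)$, and $G$ is a Coxeter group, i.e. a finite group generated by orthogonal reflections in hyperplanes of $V$. $\Sigma$ is the set of all hyperplanes $\Pi_\alpha:(\alpha,x)=0$ of reflections $s_\alpha\in G$, and $A$ is a set of (arbitrarily chosen) normals $\alpha$, one for each hyperplane. A multiplicity function is a $G$-invariant function $m$ on $\Sigma$ with values $m_\alpha\in\mathbb Z_{\ge 0}$. $S$ is the ring of polynomials on $V$ (complex coefficients); $S^G$ is the subring of $G$-invariants, freely generated by homogeneous polynomials $\sigma_1=x^2=(x,x),\sigma_2,\ldots,\sigma_n$. $\partial_\alpha=(\alpha,\partial/\partial x)$. The ring $Q_m\subset S$ of $m$-quasiinvariants consists of the polynomials $q$ with $\partial_\alpha^{s}q|_{\Pi_\alpha}=0$ for $s=1,3,\ldots,2m_\alpha-1$ and all $\alpha\in A$; it contains $S^G$. Gauged Calogero–Moser operator: $\mathcal L=\Delta-\sum_{\alpha\in A}\frac{2m_\alpha}{(\alpha,x)}\partial_\alpha$. There is a (known) algebra homomorphism $\chi_m$ from $Q_m$ to a commutative algebra of differential operators with rational coefficients, $q\mapsto\mathcal L_q$, given for homogeneous $q$ of degree $d$ by $\mathcal L_q=\chi_m(q)=\frac{1}{2^{d}d!}(\mathrm{ad}_{\mathcal L})^{d}\,\hat q$, where $\mathrm{ad}_{\mathcal L}B=\mathcal LB-B\mathcal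 L$ and $\hat q$ is multiplication by $q$, extended linearly. One has $\mathcal L_{x^2}=\mathcal L$. Set $\mathcal L_i=\chi_m(\sigma_i)$ (so $\mathcal L_1=\mathcal L$). $H_m$ is the space of $m$-harmonic polynomials: the (polynomial) solutions $\psi$ of $\mathcal L_1\psi=\cdots=\mathcal L_n\psi=0$. *)

theory Defs
  imports "HOL-Analysis.Analysis" "HOL-Algebra.Bij" "HOL-Algebra.Generated_Groups"
    "HOL-Library.Poly_Mapping"
begin

text \<open>Throughout, the Euclidean space \<open>V\<close> is a type \<^typ>\<open>'a::euclidean_space\<close>, its dimension is
  \<open>DIM('a)\<close>, and the ring \<open>S\<close> of complex polynomials on \<open>V\<close> is the set of functions
  \<open>V \<Rightarrow> complex\<close> satisfying \<^const>\<open>polynomial_function\<close>.\<close>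

subsection \<open>Coxeter groups and multiplicities\<close>

definition hyperplane :: "'a::euclidean_space \<Rightarrow> 'a set" where
  "hyperplane \<alpha> = {x. \<alpha> \<bullet> x = 0}"

definition reflection :: "'a::euclidean_space \<Rightarrow> 'a \<Rightarrow> 'a" where
  "reflection \<alpha> x = x - (2 * (\<alpha> \<bullet> x) / (\<alpha> \<bullet> \<alpha>)) *\<^sub>R \<alpha>"

definition coxeter_group :: "('a::euclidean_space \<Rightarrow> 'a) set \<Rightarrow> bool" where
  "coxeter_group G \<longleftrightarrow> finite G \<and>
     (\<exists>R. 0 \<notin> R \<and> G = generate (BijGroup UNIV) (reflection ` R))"

definition mirrors :: "('a::euclidean_space \<Rightarrow> 'a) set \<Rightarrow> 'a set set" where
  "mirrors G = {hyperplane \<alpha> |\<alpha>. \<alpha> \<noteq> 0 \<and> reflection \<alpha> \<in> G}"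

definition mirror_normals :: "('a::euclidean_space \<Rightarrow> 'a) set \<Rightarrow> 'a set \<Rightarrow> bool" where
  "mirror_normals G A \<longleftrightarrow> 0 \<notin> A \<and> bij_betw hyperplane A (mirrors G)"

text \<open>A multiplicity is a function of the hyperplane; \<open>m\<^sub>\<alpha>\<close> is \<^term>\<open>m (hyperplane \<alpha>)\<close>. Its values
  on sets that are not mirrors of \<open>G\<close> are never used.\<close>

definition multiplicity_function ::
    "('a::euclidean_space \<Rightarrow> 'a) set \<Rightarrow> ('a set \<Rightarrow> nat) \<Rightarrow> bool" where
  "multiplicity_function G m \<longleftrightarrow> (\<forall>g\<in>G. \<forall>P\<in>mirrors G. m (g ` P) = m P)"

subsection \<open>Quasiinvariants\<close>

definition dir_deriv ::
    "'a::euclidean_space \<Rightarrow> ('a \<Rightarrow> complex) \<Rightarrow> 'a \<Rightarrow> complex" where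
  "dir_deriv v f x = frechet_derivative f (at x) v"

definition quasiinvariants ::
    "'a::euclidean_space set \<Rightarrow> ('a set \<Rightarrow> nat) \<Rightarrow> ('a \<Rightarrow> complex) set" where
  "quasiinvariants A m = {q. polynomial_function q \<and>
     (\<forall>\<alpha>\<in>A. \<forall>s. odd s \<and> s < 2 * m (hyperplane \<alpha>) \<longrightarrow>
        (\<forall>x\<in>hyperplane \<alpha>. (dir_deriv \<alpha> ^^ s) q x = 0))}"

subsection \<open>Invariant polynomials and their free homogeneous generators\<close>

definition invariant_polys :: "('a::euclidean_space \<Rightarrow> 'a) set \<Rightarrow> ('a \<Rightarrow> complex) set" where
  "invariant_polys G = {p. polynomial_function p \<and> (\<forall>g\<in>G. p \<circ> g = p)}"

definition homogeneous :: "nat \<Rightarrow> ('a::euclidean_space \<Rightarrow> complex) \<Rightarrow> bool" where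
  "homogeneous d q \<longleftrightarrow> polynomial_function q \<and> (\<forall>c x. q (c *\<^sub>R x) = c ^ d *\<^sub>R q x)"

text \<open>The type \<^typ>\<open>(nat \<Rightarrow>\<^sub>0 nat) \<Rightarrow>\<^sub>0 complex\<close> is the ring of complex polynomials in
  indeterminates indexed by \<^typ>\<open>nat\<close>.\<close>

definition mpoly_vars :: "((nat \<Rightarrow>\<^sub>0 nat) \<Rightarrow>\<^sub>0 complex) \<Rightarrow> nat set" where
  "mpoly_vars P = (\<Union>e\<in>Poly_Mapping.keys P. Poly_Mapping.keys e)"

definition mpoly_eval :: "((nat \<Rightarrow>\<^sub>0 nat) \<Rightarrow>\<^sub>0 complex) \<Rightarrow> (nat \<Rightarrow> complex) \<Rightarrow> complex" where
  "mpoly_eval P z = (\<Sum>e\<in>Poly_Mapping.keys P.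
     Poly_Mapping.lookup P e * (\<Prod>i\<in>Poly_Mapping.keys e. z i ^ Poly_Mapping.lookup e i))"

text \<open>Existence of \<open>P\<close> below says that the \<open>\<sigma>\<^sub>i\<close> generate the invariants, uniqueness that they
  are algebraically independent. If \<open>G\<close> contains a reflection, free homogeneous generators with
  \<open>\<sigma>\<^sub>1 = (x,x)\<close> exist; for the trivial group all free homogeneous generators are linear, and the
  normalization of \<open>\<sigma>\<^sub>1\<close> is not imposed.\<close>

definition basic_invariants ::
    "('a::euclidean_space \<Rightarrow> 'a) set \<Rightarrow> (nat \<Rightarrow> 'a \<Rightarrow> complex) \<Rightarrow> (nat \<Rightarrow> nat) \<Rightarrow> bool" where
  "basic_invariants G \<sigma> deg \<longleftrightarrow>
     (\<forall>i\<in>{1..DIM('a)}. \<sigma> i \<in> invariant_polys G \<and> homogeneous (deg i) (\<sigma> i)) \<and>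
     (\<forall>p\<in>invariant_polys G. \<exists>!P. mpoly_vars P \<subseteq> {1..DIM('a)} \<and>
        p = (\<lambda>x. mpoly_eval P (\<lambda>i. \<sigma> i x))) \<and>
     (G \<noteq> {id} \<longrightarrow> \<sigma> 1 = (\<lambda>x. of_real (x \<bullet> x)))"

subsection \<open>Calogero--Moser operators and harmonic polynomials\<close>

text \<open>Differential operators with rational coefficients are represented by their pointwise action
  on functions. Their coefficients are regular on the open set \<open>regular_points A\<close>, so the values
  there of an iterated operator depend only on the restriction of the function to that set; the
  values on the hyperplanes themselves (where division by zero occurs) carry no meaning.\<close>

definition regular_points :: "'a::euclidean_space set \<Rightarrow> 'a set" where
  "regular_points A = {x. \<forall>\<alpha>\<in>A. \<alpha> \<bullet> x \<noteq> 0}"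

definition laplacian :: "('a::euclidean_space \<Rightarrow> complex) \<Rightarrow> 'a \<Rightarrow> complex" where
  "laplacian f x = (\<Sum>b\<in>Basis. dir_deriv b (dir_deriv b f) x)"

definition CM_operator ::
    "'a::euclidean_space set \<Rightarrow> ('a set \<Rightarrow> nat) \<Rightarrow> ('a \<Rightarrow> complex) \<Rightarrow> 'a \<Rightarrow> complex" where
  "CM_operator A m f x = laplacian f x -
     (\<Sum>\<alpha>\<in>A. (2 * real (m (hyperplane \<alpha>)) / (\<alpha> \<bullet> x)) *\<^sub>R dir_deriv \<alpha> f x)"

definition ad ::
    "(('a \<Rightarrow> complex) \<Rightarrow> 'a \<Rightarrow> complex) \<Rightarrow> (('a \<Rightarrow> complex) \<Rightarrow> 'a \<Rightarrow> complex) \<Rightarrow>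
     ('a \<Rightarrow> complex) \<Rightarrow> 'a \<Rightarrow> complex" where
  "ad L B = (\<lambda>f x. L (B f) x - B (L f) x)"

definition mult_operator :: "('a \<Rightarrow> complex) \<Rightarrow> ('a \<Rightarrow> complex) \<Rightarrow> 'a \<Rightarrow> complex" where
  "mult_operator q f x = q x * f x"

text \<open>The operator \<open>\<L>\<^sub>q = \<chi>\<^sub>m(q)\<close> for \<open>q\<close> homogeneous of degree \<open>d\<close>; as the \<open>\<sigma>\<^sub>i\<close> are homogeneous,
  the linear extension to all quasiinvariants is not needed to define the \<open>\<L>\<^sub>i\<close>.\<close>

definition chi ::
    "'a::euclidean_space set \<Rightarrow> ('a set \<Rightarrow> nat) \<Rightarrow> nat \<Rightarrow> ('a \<Rightarrow> complex) \<Rightarrow>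
     ('a \<Rightarrow> complex) \<Rightarrow> 'a \<Rightarrow> complex" where
  "chi A m d q f x =
     (1 / (2 ^ d * fact d)) * (ad (CM_operator A m) ^^ d) (mult_operator q) f x"

definition harmonics ::
    "'a::euclidean_space set \<Rightarrow> ('a set \<Rightarrow> nat) \<Rightarrow> (nat \<Rightarrow> 'a \<Rightarrow> complex) \<Rightarrow> (nat \<Rightarrow> nat) \<Rightarrow>
     ('a \<Rightarrow> complex) set" where
  "harmonics A m \<sigma> deg = {\<psi>. polynomial_function \<psi> \<and>
     (\<forall>i\<in>{1..DIM('a)}. \<forall>x\<in>regular_points A. chi A m (deg i) (\<sigma> i) \<psi> x = 0)}"

end

theory Submission
  imports Defs
begin

text \<open>Already the equation \<open>\<L>\<psi> = 0\<close> forces quasiinvariance. Since \<open>\<L>\<close> commutes with the reflection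
  \<open>s\<close> in the mirror of \<open>\<alpha>\<close>, the polynomial \<open>\<phi> = \<psi> - \<psi> \<circ> s\<close> also satisfies \<open>\<L>\<phi> = 0\<close>, and it vanishes
  on the mirror. With \<open>t = (\<alpha>,x)\<close> the exponents of \<open>\<L>\<close> at \<open>t = 0\<close> are \<open>0\<close> and \<open>2m\<^sub>\<alpha> + 1\<close>, so \<open>\<phi>\<close> is
  divisible by \<open>t\<close> to the power \<open>2m\<^sub>\<alpha> + 1\<close>. As the odd normal derivatives of \<open>\<phi>\<close> on the mirror are
  twice those of \<open>\<psi>\<close>, the latter vanish up to order \<open>2m\<^sub>\<alpha> - 1\<close>.\<close>

subsection \<open>Functions regular off the mirrors\<close>

text \<open>Membership in \<open>harmonics\<close> speaks of \<open>chi\<close> applied to \<sigma>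
  1 = (x,x), so L\<psi> = 0 must be extracted from it. With E the Euler operator, [L, (x,x)] = 4E +
  const and [L, E] = 2L; two commutators give 8L, and 8 = 2^2 * 2! is the normalization in
  \<open>chi\<close>. The obstacle is that L has poles on the mirrors and its pointwise values there
  are arbitrary, while the conclusion concerns mirror points. Equations are used off the mirrors and
  carried over by continuity in two stages. After clearing powers of t the expression is continuous
  across the mirror of \<alpha>, which reaches the points of that mirror lying on no other; density
  inside the mirror reaches the rest. What is carried over is the vanishing of the leading
  coefficient of \<phi>, so that one more factor t splits off. Functions are treated as expressions
  in constants, linear forms and inverses of the forms in A. For empty A these are the polynomials,
  and symmetry of second derivatives, composition with a reflection and division by t all follow by
  induction on the expression.\<close>

inductive rational_expr :: "'a::euclidean_space set \<Rightarrow> ('a \<Rightarrow> complex) \<Rightarrow> bool" for A where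
  const: "rational_expr A (\<lambda>x. c)"
| inner: "rational_expr A (\<lambda>x. of_real (v \<bullet> x))"
| inverse: "\<beta> \<in> A \<Longrightarrow> rational_expr A (\<lambda>x. 1 / of_real (\<beta> \<bullet> x))"
| add: "rational_expr A f \<Longrightarrow> rational_expr A g \<Longrightarrow> rational_expr A (\<lambda>x. f x + g x)"
| mult: "rational_expr A f \<Longrightarrow> rational_expr A g \<Longrightarrow> rational_expr A (\<lambda>x. f x * g x)"

text \<open>Values on the hyperplanes are left unconstrained, so that \<^const>\<open>dir_deriv\<close> and
  \<^const>\<open>CM_operator\<close>, which take junk values there, preserve the class.\<close>

definition regular_on :: "'a::euclidean_space set \<Rightarrow> ('a \<Rightarrow> complex) \<Rightarrow> bool" where
  "regular_on A f \<longleftrightarrow> (\<exists>g. rational_expr A g \<and> (\<forall>x\<in>regular_points A. f x = g x))"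

lemma regular_points_empty [simp]: "regular_points {} = UNIV"
  by (simp add: regular_points_def)

lemma open_regular_points:
  assumes "finite A" shows "open (regular_points A)"
proof -
  have "regular_points A = (\<Inter>\<alpha>\<in>A. {x. \<alpha> \<bullet> x \<noteq> 0})"
    by (auto simp: regular_points_def)
  moreover have "open {x. \<alpha> \<bullet> x \<noteq> 0}" for \<alpha> :: 'a
    by (intro open_Collect_neq continuous_intros)
  ultimately show ?thesis using assms by (auto intro: open_INT)
qed

lemma rational_expr_mono: "rational_expr A f \<Longrightarrow> A \<subseteq> B \<Longrightarrow> rational_expr B f"
  by (induction rule: rational_expr.induct) (auto intro: rational_expr.intros)

text \<open>The derivative comes as a family indexed by the direction \<open>v\<close>, so that each
  directional derivative is again an expression of the class and can be differentiated
  further.\<close>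

lemma rational_expr_has_derivative:
  assumes "rational_expr A f"
  shows "\<exists>f'. (\<forall>v. rational_expr A (f' v)) \<and>
    (\<forall>x\<in>regular_points A. (f has_derivative (\<lambda>v. f' v x)) (at x))"
  using assms
proof induction
  case (const c)
  then show ?case by (intro exI[of _ "\<lambda>v x. 0"]) (auto intro: rational_expr.intros)
next
  case (inner u)
  have "((\<lambda>x. complex_of_real (u \<bullet> x)) has_derivative (\<lambda>v. of_real (u \<bullet> v))) (at x)" for x
    by (auto intro!: derivative_eq_intros)
  then show ?case
    by (intro exI[of _ "\<lambda>v x. of_real (u \<bullet> v)"]) (auto intro: rational_expr.intros)
next
  case (inverse \<beta>)
  let ?i = "\<lambda>x. 1 / complex_of_real (\<beta> \<bullet> x)"
  have "(?i has_derivative (\<lambda>v. - of_real (\<beta> \<bullet> v) * (?i x * ?i x))) (at x)"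
    if "\<beta> \<bullet> x \<noteq> 0" for x
    using that
    by (auto intro!: derivative_eq_intros simp: fun_eq_iff)
  then show ?case using inverse
    by (intro exI[of _ "\<lambda>v x. - of_real (\<beta> \<bullet> v) * (?i x * ?i x)"])
      (intro conjI allI ballI rational_expr.intros; auto simp: regular_points_def)
next
  case (add f g)
  then obtain f' g' where *: "\<And>v. rational_expr A (f' v)" "\<And>v. rational_expr A (g' v)"
    "\<And>x. x\<in>regular_points A \<Longrightarrow> (f has_derivative (\<lambda>v. f' v x)) (at x)"
    "\<And>x. x\<in>regular_points A \<Longrightarrow> (g has_derivative (\<lambda>v. g' v x)) (at x)" by blast
  show ?case
    by (intro exI[of _ "\<lambda>v x. f' v x + g' v x"])
      (auto intro!: rational_expr.intros * has_derivative_add)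
next
  case (mult f g)
  then obtain f' g' where *: "\<And>v. rational_expr A (f' v)" "\<And>v. rational_expr A (g' v)"
    "\<And>x. x\<in>regular_points A \<Longrightarrow> (f has_derivative (\<lambda>v. f' v x)) (at x)"
    "\<And>x. x\<in>regular_points A \<Longrightarrow> (g has_derivative (\<lambda>v. g' v x)) (at x)" by blast
  show ?case
    by (intro exI[of _ "\<lambda>v x. f x * g' v x + f' v x * g x"])
      (auto intro!: rational_expr.intros * has_derivative_mult mult.hyps)
qed

lemma dir_deriv_eqI: "(f has_derivative f') (at x) \<Longrightarrow> dir_deriv v f x = f' v"
  unfolding dir_deriv_def by (metis frechet_derivative_at)

text \<open>No differentiability is assumed: functions that agree on an open set around
  \<open>x\<close> have the same candidate derivatives there, so the choice made by
  \<open>frechet_derivative\<close> is the same too.\<close>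

lemma dir_deriv_cong:
  assumes "finite A" "x \<in> regular_points A" "\<And>y. y \<in> regular_points A \<Longrightarrow> f y = g y"
  shows "dir_deriv v f x = dir_deriv v g x"
proof -
  have "(f has_derivative f') (at x) \<longleftrightarrow> (g has_derivative f') (at x)" for f'
    using assms open_regular_points[of A] has_derivative_transform_within_open[of f f' x UNIV _ g]
      has_derivative_transform_within_open[of g f' x UNIV _ f] by (metis)
  then show ?thesis by (simp add: dir_deriv_def frechet_derivative_def)
qed

lemma regular_on_has_derivative:
  assumes "finite A" "regular_on A f" "x \<in> regular_points A"
  shows "(f has_derivative (\<lambda>v. dir_deriv v f x)) (at x)"
proof -
  from assms(2) obtain g where g: "rational_expr A g" "\<forall>x\<in>regular_points A. f x = g x"
    unfolding regular_on_def by blast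
  from rational_expr_has_derivative[OF g(1)] assms(3)
  obtain D where "(g has_derivative D) (at x)" by blast
  then have "(f has_derivative D) (at x)"
    using has_derivative_transform_within_open[of g D x UNIV "regular_points A" f]
      open_regular_points[OF assms(1)] assms(3) g(2) by auto
  moreover from this have "D = (\<lambda>v. dir_deriv v f x)"
    by (simp add: fun_eq_iff dir_deriv_eqI)
  ultimately show ?thesis by simp
qed

lemma regular_on_cong:
  "regular_on A f \<Longrightarrow> (\<And>x. x \<in> regular_points A \<Longrightarrow> f x = g x) \<Longrightarrow> regular_on A g"
  unfolding regular_on_def by auto

lemma regular_on_mono:
  assumes "regular_on A f" "A \<subseteq> B" shows "regular_on B f"
proof -
  obtain g where "rational_expr A g" "\<forall>x\<in>regular_points A. f x = g x"
    using assms(1) unfolding regular_on_def by blast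
  moreover have "regular_points B \<subseteq> regular_points A"
    using assms(2) by (auto simp: regular_points_def)
  ultimately show ?thesis
    unfolding regular_on_def using rational_expr_mono[OF _ assms(2)] by blast
qed

named_theorems regular_intros

lemma regular_on_const [regular_intros]: "regular_on A (\<lambda>x. c)"
  unfolding regular_on_def using rational_expr.const by blast

lemma regular_on_inner [regular_intros]: "regular_on A (\<lambda>x. of_real (v \<bullet> x))"
  unfolding regular_on_def using rational_expr.inner by blast

lemma regular_on_inverse [regular_intros]:
  assumes "\<beta> \<in> A" shows "regular_on A (\<lambda>x. c / of_real (\<beta> \<bullet> x))"
proof -
  have "rational_expr A (\<lambda>x. c * (1 / of_real (\<beta> \<bullet> x)))"
    using assms by (intro rational_expr.intros)
  then show ?thesis unfolding regular_on_def by auto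
qed

lemma regular_on_add [regular_intros]:
  assumes "regular_on A f" "regular_on A g" shows "regular_on A (\<lambda>x. f x + g x)"
proof -
  obtain f' g' where "rational_expr A f'" "rational_expr A g'"
    "\<forall>x\<in>regular_points A. f x = f' x" "\<forall>x\<in>regular_points A. g x = g' x"
    using assms unfolding regular_on_def by blast
  then show ?thesis
    unfolding regular_on_def by (intro exI[of _ "\<lambda>x. f' x + g' x"]) (simp add: rational_expr.add)
qed

lemma regular_on_mult [regular_intros]:
  assumes "regular_on A f" "regular_on A g" shows "regular_on A (\<lambda>x. f x * g x)"
proof -
  obtain f' g' where "rational_expr A f'" "rational_expr A g'"
    "\<forall>x\<in>regular_points A. f x = f' x" "\<forall>x\<in>regular_points A. g x = g' x"
    using assms unfolding regular_on_def by blast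
  then show ?thesis
    unfolding regular_on_def by (intro exI[of _ "\<lambda>x. f' x * g' x"]) (simp add: rational_expr.mult)
qed

lemma regular_on_diff [regular_intros]:
  "regular_on A f \<Longrightarrow> regular_on A g \<Longrightarrow> regular_on A (\<lambda>x. f x - g x)"
  using regular_on_add[OF _ regular_on_mult[OF regular_on_const[of A "-1"]], of f g] by simp

lemma regular_on_power [regular_intros]:
  "regular_on A f \<Longrightarrow> regular_on A (\<lambda>x. f x ^ k)"
  by (induction k) (simp_all add: regular_intros)

lemma regular_on_sum [regular_intros]:
  "(\<And>i. i \<in> I \<Longrightarrow> regular_on A (f i)) \<Longrightarrow> regular_on A (\<lambda>x. \<Sum>i\<in>I. f i x)"
  by (induction I rule: infinite_finite_induct) (simp_all add: regular_intros)

lemma regular_on_dir_deriv [regular_intros]: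
  assumes "finite A" "regular_on A f"
  shows "regular_on A (dir_deriv v f)"
proof -
  from assms(2) obtain g where g: "rational_expr A g" "\<forall>x\<in>regular_points A. f x = g x"
    unfolding regular_on_def by blast
  from rational_expr_has_derivative[OF g(1)] obtain D where
    D: "rational_expr A (D v)" "\<And>x. x\<in>regular_points A \<Longrightarrow> (g has_derivative (\<lambda>v. D v x)) (at x)"
    by blast
  then have "dir_deriv v f x = D v x" if "x \<in> regular_points A" for x
    using dir_deriv_cong[of A x f g v] dir_deriv_eqI[OF D(2)] that g assms(1) by auto
  then show ?thesis unfolding regular_on_def using D(1) by blast
qed

lemma regular_on_continuous:
  "finite A \<Longrightarrow> regular_on A f \<Longrightarrow> x \<in> regular_points A \<Longrightarrow> isCont f x"
  using regular_on_has_derivative has_derivative_continuous by blast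

lemma linear_functional_inner:
  fixes h :: "'a::euclidean_space \<Rightarrow> real"
  assumes "linear h" shows "\<exists>v. h = (\<lambda>x. v \<bullet> x)"
  using adjoint_works[OF assms, of _ 1] by (intro exI[of _ "adjoint h 1"]) (auto simp: inner_commute)

lemma polynomial_function_rational_expr:
  assumes "polynomial_function f" shows "rational_expr {} f"
proof -
  have real: "rational_expr {} (\<lambda>x. of_real (p x))" if "real_polynomial_function p"
    for p :: "'a \<Rightarrow> real"
    using that
  proof induction
    case (linear h)
    then obtain v where "h = (\<lambda>x. v \<bullet> x)"
      using linear_functional_inner bounded_linear.linear by blast
    then show ?case by (auto intro: rational_expr.intros)
  qed (auto intro: rational_expr.intros)
  have "rational_expr {} (\<lambda>x. of_real (Re (f x)) + \<i> * of_real (Im (f x)))"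
    using assms unfolding polynomial_function_def o_def
    by (intro rational_expr.intros real) (auto simp: bounded_linear_Re bounded_linear_Im)
  then show ?thesis by (simp flip: complex_eq)
qed

lemma polynomial_function_regular_on: "polynomial_function f \<Longrightarrow> regular_on {} f"
  unfolding regular_on_def using polynomial_function_rational_expr by blast

lemma regular_on_empty_iff: "regular_on {} f \<longleftrightarrow> rational_expr {} f"
proof
  assume "regular_on {} f"
  then obtain g where "rational_expr {} g" "f = g" unfolding regular_on_def by auto
  then show "rational_expr {} f" by simp
qed (auto simp: regular_on_def)

section \<open>Rules for first directional derivatives\<close>

lemma dir_deriv_const [simp]: "dir_deriv v (\<lambda>x. c) x = 0"
  by (rule dir_deriv_eqI) simp

lemma dir_deriv_inner [simp]: "dir_deriv v (\<lambda>x. of_real (u \<bullet> x)) x = of_real (u \<bullet> v)"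
  by (rule dir_deriv_eqI) (auto intro!: derivative_eq_intros)

lemma dir_deriv_inverse:
  assumes "\<beta> \<bullet> x \<noteq> 0"
  shows "dir_deriv v (\<lambda>x. c / of_real (\<beta> \<bullet> x)) x =
    - c * of_real (\<beta> \<bullet> v) / of_real (\<beta> \<bullet> x) ^ 2"
  by (rule dir_deriv_eqI)
    (use assms in \<open>auto intro!: derivative_eq_intros simp: fun_eq_iff power2_eq_square\<close>)

context
  fixes A :: "'a::euclidean_space set" and f g :: "'a \<Rightarrow> complex" and x :: 'a
  assumes A: "finite A" and f: "regular_on A f" and g: "regular_on A g"
    and x: "x \<in> regular_points A"
begin

lemma dir_deriv_add: "dir_deriv v (\<lambda>x. f x + g x) x = dir_deriv v f x + dir_deriv v g x"
  by (rule dir_deriv_eqI) (intro has_derivative_add regular_on_has_derivative[OF A _ x] f g)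

lemma dir_deriv_diff: "dir_deriv v (\<lambda>x. f x - g x) x = dir_deriv v f x - dir_deriv v g x"
  by (rule dir_deriv_eqI) (intro has_derivative_diff regular_on_has_derivative[OF A _ x] f g)

lemma dir_deriv_mult:
  "dir_deriv v (\<lambda>x. f x * g x) x = f x * dir_deriv v g x + dir_deriv v f x * g x"
  by (rule dir_deriv_eqI) (intro has_derivative_mult regular_on_has_derivative[OF A _ x] f g)

end

lemma dir_deriv_linear:
  "finite A \<Longrightarrow> regular_on A f \<Longrightarrow> x \<in> regular_points A \<Longrightarrow> linear (\<lambda>v. dir_deriv v f x)"
  using regular_on_has_derivative has_derivative_linear by blast

lemma dir_deriv_sum:
  assumes "finite A" "x \<in> regular_points A" "\<And>i. i \<in> I \<Longrightarrow> regular_on A (f i)"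
  shows "dir_deriv v (\<lambda>x. \<Sum>i\<in>I. f i x) x = (\<Sum>i\<in>I. dir_deriv v (f i) x)"
  by (rule dir_deriv_eqI)
    (intro has_derivative_sum regular_on_has_derivative[OF assms(1) _ assms(2)] assms(3))

text \<open>Induction over the expression. With the empty mirror set the sum and product rules are
  identities of functions on the whole space and can be rewritten under a second derivative; the
  \<open>inverse\<close> case is void.\<close>

lemma dir_deriv_commute:
  assumes "regular_on {} f"
  shows "dir_deriv u (dir_deriv v f) = dir_deriv v (dir_deriv u f)"
proof -
  have "rational_expr {} f" using assms by (simp add: regular_on_empty_iff)
  then show ?thesis
  proof induction
    case (const c)
    then show ?case by (simp add: dir_deriv_const[abs_def])
  next
    case (inner w)
    then show ?case by (simp add: dir_deriv_inner[abs_def] dir_deriv_const[abs_def])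
  next
    case (add f g)
    then have r: "regular_on {} f" "regular_on {} g" by (simp_all add: regular_on_empty_iff)
    then have D: "dir_deriv w (\<lambda>x. f x + g x) = (\<lambda>x. dir_deriv w f x + dir_deriv w g x)" for w
      using dir_deriv_add[of "{}" f g] by auto
    show ?case
      using add.IH r by (auto simp: D fun_eq_iff dir_deriv_add[of "{}"] regular_intros)
  next
    case (mult f g)
    then have r: "regular_on {} f" "regular_on {} g" by (simp_all add: regular_on_empty_iff)
    then have D: "dir_deriv w (\<lambda>x. f x * g x) = (\<lambda>x. f x * dir_deriv w g x + dir_deriv w f x * g x)"
      for w using dir_deriv_mult[of "{}" f g] by auto
    show ?case
      using mult.IH r
      by (auto simp: D fun_eq_iff dir_deriv_add[of "{}"] dir_deriv_mult[of "{}"] regular_intros)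
  qed simp
qed

subsection \<open>The Calogero--Moser operator and its commutator with the squared norm\<close>

lemma dir_deriv_mult2:
  assumes "finite A" "regular_on A f" "regular_on A g" "x \<in> regular_points A"
  shows "dir_deriv u (dir_deriv v (\<lambda>x. f x * g x)) x =
    f x * dir_deriv u (dir_deriv v g) x + dir_deriv u f x * dir_deriv v g x
    + dir_deriv v f x * dir_deriv u g x + dir_deriv u (dir_deriv v f) x * g x"
proof -
  note r = assms(2,3) regular_on_dir_deriv[OF assms(1)]
  have "dir_deriv u (dir_deriv v (\<lambda>x. f x * g x)) x =
    dir_deriv u (\<lambda>x. f x * dir_deriv v g x + dir_deriv v f x * g x) x"
    using assms by (intro dir_deriv_cong[of A] dir_deriv_mult[of A])
  then show ?thesis
    using assms by (simp add: dir_deriv_add[of A] dir_deriv_mult[of A] r regular_intros)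
qed

lemma dir_deriv_add2:
  assumes "finite A" "regular_on A f" "regular_on A g" "x \<in> regular_points A"
  shows "dir_deriv u (dir_deriv v (\<lambda>x. f x + g x)) x =
    dir_deriv u (dir_deriv v f) x + dir_deriv u (dir_deriv v g) x"
proof -
  have "dir_deriv u (dir_deriv v (\<lambda>x. f x + g x)) x =
    dir_deriv u (\<lambda>x. dir_deriv v f x + dir_deriv v g x) x"
    using assms by (intro dir_deriv_cong[of A] dir_deriv_add[of A])
  then show ?thesis
    using assms by (simp add: dir_deriv_add[of A] regular_intros)
qed

lemma dir_deriv_cong2:
  assumes "finite A" "x \<in> regular_points A" "\<And>y. y \<in> regular_points A \<Longrightarrow> f y = g y"
  shows "dir_deriv u (dir_deriv v f) x = dir_deriv u (dir_deriv v g) x"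
  using assms by (intro dir_deriv_cong[of A]) auto

lemma dir_deriv_expand:
  fixes x :: "'a::euclidean_space"
  assumes "finite A" "regular_on A f" "x \<in> regular_points A"
  shows "dir_deriv v f x = (\<Sum>b\<in>Basis. of_real (b \<bullet> v) * dir_deriv b f x)"
proof -
  interpret linear "\<lambda>v. dir_deriv v f x" by (rule dir_deriv_linear[OF assms])
  have "dir_deriv v f x = dir_deriv (\<Sum>b\<in>Basis. (v \<bullet> b) *\<^sub>R b) f x"
    by (simp add: euclidean_representation)
  also have "\<dots> = (\<Sum>b\<in>Basis. (v \<bullet> b) *\<^sub>R dir_deriv b f x)"
    by (simp only: sum scale)
  finally show ?thesis by (simp add: scaleR_conv_of_real inner_commute)
qed

lemma regular_on_norm_square [regular_intros]: "regular_on A (\<lambda>x. of_real (x \<bullet> x))"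
proof -
  have "complex_of_real (x \<bullet> x) = (\<Sum>b\<in>Basis. of_real (b \<bullet> x) * of_real (b \<bullet> x))" for x :: 'a
    by (subst euclidean_inner) (simp add: inner_commute)
  then show ?thesis by (simp add: regular_intros)
qed

lemma regular_on_euler [regular_intros]:
  assumes "finite A" "regular_on A f" shows "regular_on A (\<lambda>x. dir_deriv x f x)"
proof (rule regular_on_cong)
  show "regular_on A (\<lambda>x. \<Sum>b\<in>Basis. of_real (b \<bullet> x) * dir_deriv b f x)"
    using assms by (intro regular_intros)
qed (rule dir_deriv_expand[OF assms, symmetric])

lemma dir_deriv_norm_square:
  "dir_deriv v (\<lambda>x. of_real (x \<bullet> x)) = (\<lambda>x. of_real ((2 *\<^sub>R v) \<bullet> x))"
  by (rule ext, rule dir_deriv_eqI)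
    (auto intro!: derivative_eq_intros simp: inner_commute fun_eq_iff)

lemma sum_Basis_inner: "(\<Sum>b\<in>Basis. (x \<bullet> b) * (y \<bullet> b)) = x \<bullet> y"
  by (simp add: euclidean_inner[of x y])

lemma regular_on_laplacian [regular_intros]:
  "finite A \<Longrightarrow> regular_on A f \<Longrightarrow> regular_on A (laplacian f)"
  unfolding laplacian_def[abs_def] by (intro regular_intros)

text \<open>The value is complex so that the first order coefficients of L become quotients of the
  form covered by \<open>regular_on_inverse\<close>.\<close>

definition coupling :: "('a::euclidean_space set \<Rightarrow> nat) \<Rightarrow> 'a \<Rightarrow> complex" where
  "coupling m \<alpha> = of_nat (2 * m (hyperplane \<alpha>))"

lemma CM_operator_eq:
  "CM_operator A m f x = laplacian f x -
     (\<Sum>\<alpha>\<in>A. coupling m \<alpha> / of_real (\<alpha> \<bullet> x) * dir_deriv \<alpha> f x)"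
  by (simp add: CM_operator_def coupling_def scaleR_conv_of_real)

context
  fixes A :: "'a::euclidean_space set" and m :: "'a set \<Rightarrow> nat"
  assumes A: "finite A"
begin

lemma regular_on_CM_operator [regular_intros]:
  "regular_on A f \<Longrightarrow> regular_on A (CM_operator A m f)"
  unfolding CM_operator_eq[abs_def] using A by (intro regular_intros)

lemma CM_operator_cong:
  assumes "x \<in> regular_points A" "\<And>y. y \<in> regular_points A \<Longrightarrow> f y = g y"
  shows "CM_operator A m f x = CM_operator A m g x"
proof -
  have "dir_deriv v f x = dir_deriv v g x" "laplacian f x = laplacian g x" for v
    unfolding laplacian_def using assms A by (auto intro!: sum.cong dir_deriv_cong2 dir_deriv_cong)
  then show ?thesis by (simp add: CM_operator_eq)
qed

lemma CM_operator_add: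
  assumes "regular_on A f" "regular_on A g" "x \<in> regular_points A"
  shows "CM_operator A m (\<lambda>x. f x + g x) x = CM_operator A m f x + CM_operator A m g x"
  using assms A
  by (simp add: CM_operator_eq laplacian_def dir_deriv_add[of A] dir_deriv_add2[of A]
      sum.distrib algebra_simps)

text \<open>The first order part of L is a derivation, so only the Laplacian produces a cross term,
  twice the product of the gradients.\<close>

lemma CM_operator_mult:
  assumes "regular_on A f" "regular_on A g" "x \<in> regular_points A"
  shows "CM_operator A m (\<lambda>x. f x * g x) x = f x * CM_operator A m g x + g x * CM_operator A m f x
    + 2 * (\<Sum>b\<in>Basis. dir_deriv b f x * dir_deriv b g x)"
proof -
  have 1: "laplacian (\<lambda>x. f x * g x) x = f x * laplacian g x + g x * laplacian f x
    + 2 * (\<Sum>b\<in>Basis. dir_deriv b f x * dir_deriv b g x)"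
    unfolding laplacian_def sum_distrib_left sum.distrib[symmetric] dir_deriv_mult2[OF A assms]
    by (rule sum.cong) (simp_all add: algebra_simps)
  have 2: "(\<Sum>\<alpha>\<in>A. coupling m \<alpha> / of_real (\<alpha> \<bullet> x) * dir_deriv \<alpha> (\<lambda>x. f x * g x) x)
    = f x * (\<Sum>\<alpha>\<in>A. coupling m \<alpha> / of_real (\<alpha> \<bullet> x) * dir_deriv \<alpha> g x)
    + g x * (\<Sum>\<alpha>\<in>A. coupling m \<alpha> / of_real (\<alpha> \<bullet> x) * dir_deriv \<alpha> f x)"
    unfolding sum_distrib_left sum.distrib[symmetric] dir_deriv_mult[OF A assms]
    by (rule sum.cong) (simp_all add: algebra_simps)
  show ?thesis unfolding CM_operator_eq 1 2 by (simp add: algebra_simps)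
qed

lemma CM_operator_const: "CM_operator A m (\<lambda>x. c) x = 0"
  by (simp add: CM_operator_eq laplacian_def dir_deriv_const[abs_def])

lemma CM_operator_cmult:
  assumes "regular_on A f" "x \<in> regular_points A"
  shows "CM_operator A m (\<lambda>x. c * f x) x = c * CM_operator A m f x"
  using CM_operator_mult[OF regular_on_const assms] by (simp add: CM_operator_const)

lemma CM_operator_sum:
  assumes "\<And>i. i \<in> I \<Longrightarrow> regular_on A (f i)" "x \<in> regular_points A"
  shows "CM_operator A m (\<lambda>x. \<Sum>i\<in>I. f i x) x = (\<Sum>i\<in>I. CM_operator A m (f i) x)"
  using assms(1)
  by (induction I rule: infinite_finite_induct)
    (simp_all add: CM_operator_const CM_operator_add assms(2) regular_intros)

lemma CM_operator_inner:
  "CM_operator A m (\<lambda>x. of_real (v \<bullet> x)) x =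
     - (\<Sum>\<alpha>\<in>A. coupling m \<alpha> / of_real (\<alpha> \<bullet> x) * of_real (v \<bullet> \<alpha>))"
  by (simp add: CM_operator_eq laplacian_def dir_deriv_inner[abs_def] dir_deriv_const[abs_def])

text \<open>The derivative of (x,x) along \<alpha> is 2(\<alpha>,x), which cancels the pole at the
  mirror of \<alpha>; hence a constant remains.\<close>

lemma CM_operator_norm_square:
  assumes "x \<in> regular_points A"
  shows "CM_operator A m (\<lambda>x. of_real (x \<bullet> x)) x = of_nat (2 * DIM('a)) - 2 * (\<Sum>\<alpha>\<in>A. coupling m \<alpha>)"
proof -
  have "laplacian (\<lambda>x::'a. of_real (x \<bullet> x)) x = (\<Sum>b::'a\<in>Basis. 2)"
    unfolding laplacian_def dir_deriv_norm_square dir_deriv_inner by (rule sum.cong) auto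
  moreover have "(\<Sum>\<alpha>\<in>A. coupling m \<alpha> / of_real (\<alpha> \<bullet> x) * of_real ((2 *\<^sub>R \<alpha>) \<bullet> x)) = (\<Sum>\<alpha>\<in>A. 2 * coupling m \<alpha>)"
    by (rule sum.cong) (use assms in \<open>auto simp: regular_points_def\<close>)
  ultimately show ?thesis
    by (simp add: CM_operator_eq dir_deriv_norm_square sum_distrib_left)
qed

lemma CM_operator_norm_square_mult:
  assumes "regular_on A g" "x \<in> regular_points A"
  shows "CM_operator A m (\<lambda>x. of_real (x \<bullet> x) * g x) x - of_real (x \<bullet> x) * CM_operator A m g x =
    4 * dir_deriv x g x + (of_nat (2 * DIM('a)) - 2 * (\<Sum>\<alpha>\<in>A. coupling m \<alpha>)) * g x"
proof -
  have *: "2 * (\<Sum>b\<in>Basis. dir_deriv b (\<lambda>x. of_real (x \<bullet> x)) x * dir_deriv b g x)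
    = 4 * dir_deriv x g x"
    by (subst dir_deriv_expand[OF A assms, of x])
      (simp add: dir_deriv_norm_square sum_distrib_left mult_ac)
  show ?thesis
    unfolding CM_operator_mult[OF regular_on_norm_square assms] * CM_operator_norm_square[OF assms(2)]
    by (simp add: algebra_simps)
qed

text \<open>The operator lowers the degree by two: its commutator with the Euler operator is twice itself.\<close>

lemma CM_operator_euler:
  assumes f: "regular_on {} f" and x: "x \<in> regular_points A"
  shows "CM_operator A m (\<lambda>x. dir_deriv x f x) x - dir_deriv x (CM_operator A m f) x
    = 2 * CM_operator A m f x"
proof -
  have fA: "regular_on A f" using f regular_on_mono by blast
  have ax: "\<alpha> \<bullet> x \<noteq> 0" if "\<alpha> \<in> A" for \<alpha> using x that by (auto simp: regular_points_def)
  \<comment> \<open>The two sides of the commutator are brought to the forms LEf = T - S + 2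
    \<open>laplacian f\<close> and ELf = T + S; their difference is twice \<open>laplacian f\<close>
    - S, that is, 2Lf.\<close>
  define S where "S = (\<Sum>\<alpha>\<in>A. coupling m \<alpha> / of_real (\<alpha> \<bullet> x) * dir_deriv \<alpha> f x)"
  define T where "T = (\<Sum>b\<in>Basis. of_real (b \<bullet> x) * CM_operator A m (dir_deriv b f) x)"
  note reg = regular_on_dir_deriv[OF A] fA regular_intros
  have "CM_operator A m (\<lambda>x. dir_deriv x f x) x
    = CM_operator A m (\<lambda>x. \<Sum>b\<in>Basis. of_real (b \<bullet> x) * dir_deriv b f x) x"
    by (rule CM_operator_cong[OF x]) (rule dir_deriv_expand[OF A fA])
  also have "\<dots> = (\<Sum>b\<in>Basis. CM_operator A m (\<lambda>x. of_real (b \<bullet> x) * dir_deriv b f x) x)"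
    by (intro CM_operator_sum x reg A)
  also have "\<dots> = (\<Sum>b\<in>Basis. of_real (b \<bullet> x) * CM_operator A m (dir_deriv b f) x
      - dir_deriv b f x * (\<Sum>\<alpha>\<in>A. coupling m \<alpha> / of_real (\<alpha> \<bullet> x) * of_real (b \<bullet> \<alpha>))
      + 2 * dir_deriv b (dir_deriv b f) x)"
  proof (rule sum.cong[OF refl])
    fix b :: 'a assume b: "b \<in> Basis"
    have "(\<Sum>c\<in>Basis. dir_deriv c (\<lambda>x. of_real (b \<bullet> x)) x * dir_deriv c (dir_deriv b f) x)
      = (\<Sum>c\<in>Basis. (if c = b then dir_deriv b (dir_deriv b f) x else 0))"
      by (rule sum.cong) (use b in \<open>auto simp: inner_Basis\<close>)
    also have "\<dots> = dir_deriv b (dir_deriv b f) x" using b by simp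
    finally show "CM_operator A m (\<lambda>x. of_real (b \<bullet> x) * dir_deriv b f x) x =
      of_real (b \<bullet> x) * CM_operator A m (dir_deriv b f) x
      - dir_deriv b f x * (\<Sum>\<alpha>\<in>A. coupling m \<alpha> / of_real (\<alpha> \<bullet> x) * of_real (b \<bullet> \<alpha>))
      + 2 * dir_deriv b (dir_deriv b f) x"
      by (subst CM_operator_mult) (simp_all add: CM_operator_inner x reg A)
  qed
  also have "\<dots> = T - (\<Sum>b\<in>Basis. \<Sum>\<alpha>\<in>A. dir_deriv b f x * (coupling m \<alpha> / of_real (\<alpha> \<bullet> x) * of_real (b \<bullet> \<alpha>)))
      + 2 * laplacian f x"
    by (simp add: sum.distrib sum_subtractf sum_distrib_left laplacian_def T_def)
  also have "(\<Sum>b\<in>Basis. \<Sum>\<alpha>\<in>A. dir_deriv b f x * (coupling m \<alpha> / of_real (\<alpha> \<bullet> x) * of_real (b \<bullet> \<alpha>))) = S"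
    unfolding S_def
  proof (subst sum.swap, rule sum.cong[OF refl])
    fix \<alpha> assume "\<alpha> \<in> A"
    show "(\<Sum>b\<in>Basis. dir_deriv b f x * (coupling m \<alpha> / of_real (\<alpha> \<bullet> x) * of_real (b \<bullet> \<alpha>)))
      = coupling m \<alpha> / of_real (\<alpha> \<bullet> x) * dir_deriv \<alpha> f x"
      by (subst dir_deriv_expand[OF A fA x, of \<alpha>]) (simp add: sum_distrib_left mult_ac)
  qed
  finally have 1: "CM_operator A m (\<lambda>x. dir_deriv x f x) x = T - S + 2 * laplacian f x" .
  \<comment> \<open>A constant direction commutes with all derivatives, so the extra term comes
    solely from differentiating the coefficients 1/(\<alpha>,x). When these terms are weighted by
    (b,x) and summed over the basis, one factor (\<alpha>,x) cancels and S results.\<close>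
  have D: "dir_deriv b (CM_operator A m f) x = CM_operator A m (dir_deriv b f) x
    + (\<Sum>\<alpha>\<in>A. coupling m \<alpha> * of_real (\<alpha> \<bullet> b) / of_real (\<alpha> \<bullet> x) ^ 2 * dir_deriv \<alpha> f x)" for b
  proof -
    have lap: "dir_deriv b (laplacian f) x = laplacian (dir_deriv b f) x"
    proof -
      have "dir_deriv b (laplacian f) x = (\<Sum>c\<in>Basis. dir_deriv b (dir_deriv c (dir_deriv c f)) x)"
        unfolding laplacian_def[abs_def] by (intro dir_deriv_sum[OF A x] reg A)
      then show ?thesis
        using f dir_deriv_commute[of _ b] regular_on_dir_deriv[of "{}" f]
        by (simp add: laplacian_def)
    qed
    have "dir_deriv b (CM_operator A m f) x = dir_deriv b (laplacian f) x
      - dir_deriv b (\<lambda>x. \<Sum>\<alpha>\<in>A. coupling m \<alpha> / of_real (\<alpha> \<bullet> x) * dir_deriv \<alpha> f x) x"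
      unfolding CM_operator_eq[abs_def] by (intro dir_deriv_diff[OF A] reg A x)
    also have "dir_deriv b (\<lambda>x. \<Sum>\<alpha>\<in>A. coupling m \<alpha> / of_real (\<alpha> \<bullet> x) * dir_deriv \<alpha> f x) x
      = (\<Sum>\<alpha>\<in>A. dir_deriv b (\<lambda>x. coupling m \<alpha> / of_real (\<alpha> \<bullet> x) * dir_deriv \<alpha> f x) x)"
      by (intro dir_deriv_sum[OF A x] reg A)
    also have "\<dots> = (\<Sum>\<alpha>\<in>A. coupling m \<alpha> / of_real (\<alpha> \<bullet> x) * dir_deriv \<alpha> (dir_deriv b f) x
      - coupling m \<alpha> * of_real (\<alpha> \<bullet> b) / of_real (\<alpha> \<bullet> x) ^ 2 * dir_deriv \<alpha> f x)"
      by (rule sum.cong[OF refl], subst dir_deriv_mult[OF A])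
        (auto simp: dir_deriv_inverse ax x reg A dir_deriv_commute[OF f, of b])
    finally show ?thesis
      unfolding CM_operator_eq[of _ _ "dir_deriv b f"] lap by (simp add: sum_subtractf)
  qed
  have "dir_deriv x (CM_operator A m f) x = T + (\<Sum>b\<in>Basis. \<Sum>\<alpha>\<in>A. of_real (b \<bullet> x) *
      (coupling m \<alpha> * of_real (\<alpha> \<bullet> b) / of_real (\<alpha> \<bullet> x) ^ 2 * dir_deriv \<alpha> f x))"
    using x fA
    by (subst dir_deriv_expand[OF A regular_on_CM_operator])
      (auto simp: D T_def distrib_left sum.distrib sum_distrib_left)
  also have "(\<Sum>b\<in>Basis. \<Sum>\<alpha>\<in>A. of_real (b \<bullet> x) *
      (coupling m \<alpha> * of_real (\<alpha> \<bullet> b) / of_real (\<alpha> \<bullet> x) ^ 2 * dir_deriv \<alpha> f x)) = S"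
    unfolding S_def
  proof (subst sum.swap, rule sum.cong[OF refl])
    fix \<alpha> assume a: "\<alpha> \<in> A"
    have "(\<Sum>b\<in>Basis. of_real (b \<bullet> x) *
      (coupling m \<alpha> * of_real (\<alpha> \<bullet> b) / of_real (\<alpha> \<bullet> x) ^ 2 * dir_deriv \<alpha> f x))
      = of_real (\<Sum>b\<in>Basis. (\<alpha> \<bullet> b) * (x \<bullet> b)) * (coupling m \<alpha> / of_real (\<alpha> \<bullet> x) ^ 2 * dir_deriv \<alpha> f x)"
      unfolding of_real_sum sum_distrib_right
      by (rule sum.cong) (simp_all add: inner_commute mult_ac)
    then show "(\<Sum>b\<in>Basis. of_real (b \<bullet> x) *
      (coupling m \<alpha> * of_real (\<alpha> \<bullet> b) / of_real (\<alpha> \<bullet> x) ^ 2 * dir_deriv \<alpha> f x))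
      = coupling m \<alpha> / of_real (\<alpha> \<bullet> x) * dir_deriv \<alpha> f x"
      using ax[OF a] by (simp add: sum_Basis_inner power2_eq_square)
  qed
  finally have 2: "dir_deriv x (CM_operator A m f) x = T + S" .
  show ?thesis unfolding 1 2 CM_operator_eq[of _ _ f] S_def[symmetric] by (simp add: algebra_simps)
qed

lemma chi_norm_square:
  assumes f: "regular_on {} f" and x: "x \<in> regular_points A"
  shows "chi A m 2 (\<lambda>x. of_real (x \<bullet> x)) f x = CM_operator A m f x"
proof -
  define k where "k = of_nat (2 * DIM('a)) - 2 * (\<Sum>\<alpha>\<in>A. coupling m \<alpha>)"
  have fA: "regular_on A f" using f regular_on_mono by blast
  let ?L = "CM_operator A m" and ?B = "ad (CM_operator A m) (mult_operator (\<lambda>x. of_real (x \<bullet> x)))"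
  \<comment> \<open>Needed for every \<open>g\<close> regular off the mirrors, since the outer
    commutator applies it both to \<open>f\<close> and to Lf, which may have poles.\<close>
  have B: "?B g y = 4 * dir_deriv y g y + k * g y" if "regular_on A g" "y \<in> regular_points A" for g y
    using CM_operator_norm_square_mult[OF that]
    by (simp add: ad_def mult_operator_def[abs_def] k_def)
  have "?L (?B f) x = ?L (\<lambda>y. 4 * dir_deriv y f y + k * f y) x"
    using B[OF fA] by (intro CM_operator_cong x)
  also have "\<dots> = 4 * ?L (\<lambda>y. dir_deriv y f y) x + k * ?L f x"
    using x A fA by (simp add: CM_operator_add CM_operator_cmult regular_intros)
  \<comment> \<open>The scalar \<open>k\<close> commutes with L and drops out; the factor 8 is 4
    from \<open>B\<close> times 2 from \<open>CM_operator_euler\<close>.\<close>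
  finally have "ad ?L ?B f x = 8 * ?L f x"
    using B[OF regular_on_CM_operator[OF fA] x] CM_operator_euler[OF f x]
    by (simp add: ad_def algebra_simps)
  moreover have "(ad ?L ^^ 2) (mult_operator (\<lambda>x. of_real (x \<bullet> x))) = ad ?L ?B"
    by (simp add: eval_nat_numeral)
  ultimately show ?thesis by (simp add: chi_def)
qed

end

subsection \<open>Invariance under the reflections\<close>

lemma linear_reflection: "linear (reflection \<alpha>)"
  unfolding reflection_def
  by (rule linearI) (simp_all add: inner_add_right add_divide_distrib algebra_simps)

lemma reflection_self_adjoint: "v \<bullet> reflection \<alpha> x = reflection \<alpha> v \<bullet> x"
  by (simp add: reflection_def inner_diff_left inner_diff_right inner_commute)

lemma reflection_involution: "\<alpha> \<noteq> 0 \<Longrightarrow> reflection \<alpha> (reflection \<alpha> x) = x"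
  by (simp add: reflection_def inner_diff_right)

lemma reflection_inner: "\<alpha> \<noteq> 0 \<Longrightarrow> reflection \<alpha> x \<bullet> reflection \<alpha> y = x \<bullet> y"
  by (simp add: reflection_self_adjoint reflection_involution)

lemma reflection_normal: "\<alpha> \<noteq> 0 \<Longrightarrow> reflection \<alpha> \<alpha> = - \<alpha>"
  by (simp add: reflection_def scaleR_2)

lemma reflection_fixed_points: "\<alpha> \<noteq> 0 \<Longrightarrow> {x. reflection \<alpha> x = x} = hyperplane \<alpha>"
  by (auto simp: reflection_def hyperplane_def)

lemma reflection_conjugate:
  assumes "\<alpha> \<noteq> 0"
  shows "reflection (reflection \<alpha> \<beta>) = reflection \<alpha> \<circ> reflection \<beta> \<circ> reflection \<alpha>"
proof
  fix x
  let ?s = "reflection \<alpha>"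
  interpret linear ?s by (rule linear_reflection)
  have "?s (reflection \<beta> (?s x)) = ?s (?s x) - (2 * (\<beta> \<bullet> ?s x) / (\<beta> \<bullet> \<beta>)) *\<^sub>R ?s \<beta>"
    unfolding reflection_def[of \<beta>] by (simp only: diff scale)
  then show "reflection (?s \<beta>) x = (?s \<circ> reflection \<beta> \<circ> ?s) x"
    using assms
    by (simp add: reflection_involution reflection_def[of "?s \<beta>"] reflection_inner
        reflection_self_adjoint[of \<beta>])
qed

lemma reflection_hyperplane:
  assumes "\<alpha> \<noteq> 0" shows "reflection \<alpha> ` hyperplane \<beta> = hyperplane (reflection \<alpha> \<beta>)"
proof (intro equalityI subsetI)
  fix x assume "x \<in> hyperplane (reflection \<alpha> \<beta>)"
  then have "reflection \<alpha> x \<in> hyperplane \<beta>"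
    by (simp add: hyperplane_def reflection_self_adjoint)
  then show "x \<in> reflection \<alpha> ` hyperplane \<beta>"
    using reflection_involution[OF assms, of x] by (metis imageI)
qed (use assms in \<open>auto simp: hyperplane_def reflection_inner\<close>)

text \<open>The component \<open>?z\<close> of \<beta> orthogonal to \<alpha> lies in the first
  hyperplane, hence is orthogonal to \<beta> as well and so to itself. The scalar may be 0, because
  \<beta> may be.\<close>

lemma hyperplane_subset_imp_parallel:
  assumes "\<alpha> \<noteq> 0" "hyperplane \<alpha> \<subseteq> hyperplane \<beta>"
  shows "\<exists>c. \<beta> = c *\<^sub>R \<alpha>"
proof -
  let ?c = "(\<alpha> \<bullet> \<beta>) / (\<alpha> \<bullet> \<alpha>)"
  let ?z = "\<beta> - ?c *\<^sub>R \<alpha>"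
  have z: "\<alpha> \<bullet> ?z = 0" using assms(1) by (simp add: inner_diff_right)
  then have "?z \<in> hyperplane \<beta>" using assms(2) by (auto simp: hyperplane_def)
  then have "\<beta> \<bullet> ?z = 0" by (simp add: hyperplane_def)
  with z have "?z \<bullet> ?z = 0" by (simp only: inner_diff_left inner_scaleR_left)
  then have "\<beta> = ?c *\<^sub>R \<alpha>" by simp
  then show ?thesis ..
qed

lemma regular_on_reflection:
  assumes "regular_on {} f" shows "regular_on {} (\<lambda>x. f (reflection \<alpha> x))"
proof -
  have "rational_expr {} f" using assms by (simp add: regular_on_empty_iff)
  then have "rational_expr {} (\<lambda>x. f (reflection \<alpha> x))"
    by induction (auto intro: rational_expr.intros simp: reflection_self_adjoint)
  then show ?thesis by (simp add: regular_on_empty_iff)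
qed

lemma dir_deriv_reflection:
  assumes "regular_on {} f"
  shows "dir_deriv v (\<lambda>x. f (reflection \<alpha> x)) = (\<lambda>x. dir_deriv (reflection \<alpha> v) f (reflection \<alpha> x))"
proof (rule ext, rule dir_deriv_eqI)
  fix x
  have 1: "(reflection \<alpha> has_derivative reflection \<alpha>) (at x)"
    by (intro linear_imp_has_derivative linear_reflection)
  have 2: "(f has_derivative (\<lambda>v. dir_deriv v f (reflection \<alpha> x))) (at (reflection \<alpha> x))"
    using assms by (intro regular_on_has_derivative[of "{}"]) auto
  show "((\<lambda>x. f (reflection \<alpha> x)) has_derivative
    (\<lambda>v. dir_deriv (reflection \<alpha> v) f (reflection \<alpha> x))) (at x)"
    using has_derivative_compose[OF 1 2] .
qed

lemma dir_deriv_expand2: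
  fixes x :: "'a::euclidean_space"
  assumes "regular_on {} f"
  shows "dir_deriv u (dir_deriv v f) x =
    (\<Sum>c\<in>Basis. \<Sum>d\<in>Basis. of_real ((d \<bullet> u) * (c \<bullet> v)) * dir_deriv d (dir_deriv c f) x)"
proof -
  have r: "regular_on {} (dir_deriv c f)" for c
    using assms by (intro regular_on_dir_deriv) auto
  have v: "dir_deriv v f = (\<lambda>x. \<Sum>c\<in>Basis. of_real (c \<bullet> v) * dir_deriv c f x)"
    by (rule ext, rule dir_deriv_expand[OF _ assms]) auto
  have "dir_deriv u (dir_deriv v f) x
    = (\<Sum>c\<in>Basis. dir_deriv u (\<lambda>x. of_real (c \<bullet> v) * dir_deriv c f x) x)"
    unfolding v by (intro dir_deriv_sum[of "{}"] regular_intros r) auto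
  also have "\<dots> = (\<Sum>c\<in>Basis. of_real (c \<bullet> v) * dir_deriv u (dir_deriv c f) x)"
    by (intro sum.cong refl, subst dir_deriv_mult[of "{}"]) (auto intro: r regular_on_const)
  also have "\<dots> = (\<Sum>c\<in>Basis. \<Sum>d\<in>Basis. of_real ((d \<bullet> u) * (c \<bullet> v)) * dir_deriv d (dir_deriv c f) x)"
    by (intro sum.cong refl, subst dir_deriv_expand[OF _ r, of _ u])
      (auto simp: sum_distrib_left mult_ac)
  finally show ?thesis .
qed

text \<open>The Laplacian is the trace of the Hessian, which is the same in every orthonormal basis.
  Here the reflected basis is compared with \<open>Basis\<close>; \<open>orth\<close> is Parseval's
  identity for the former.\<close>

lemma laplacian_reflection:
  fixes f :: "'a::euclidean_space \<Rightarrow> complex"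
  assumes f: "regular_on {} f" and a: "\<alpha> \<noteq> 0"
  shows "laplacian (\<lambda>x. f (reflection \<alpha> x)) x = laplacian f (reflection \<alpha> x)"
proof -
  let ?s = "reflection \<alpha>"
  let ?D = "\<lambda>d c. dir_deriv d (dir_deriv c f) (?s x)"
  have r: "regular_on {} (dir_deriv c f)" for c
    using f by (intro regular_on_dir_deriv) auto
  have orth: "(\<Sum>b\<in>Basis. (d \<bullet> ?s b) * (c \<bullet> ?s b)) = d \<bullet> c" for c d :: 'a
    using a by (simp add: reflection_self_adjoint sum_Basis_inner reflection_involution)
  have "laplacian (\<lambda>x. f (?s x)) x = (\<Sum>b\<in>Basis. ?D (?s b) (?s b))"
    by (simp add: laplacian_def dir_deriv_reflection[OF f] dir_deriv_reflection[OF r])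
  also have "\<dots> = (\<Sum>b\<in>Basis. \<Sum>c\<in>Basis. \<Sum>d\<in>Basis. of_real ((d \<bullet> ?s b) * (c \<bullet> ?s b)) * ?D d c)"
    by (intro sum.cong refl dir_deriv_expand2[OF f])
  also have "\<dots> = (\<Sum>c\<in>Basis. \<Sum>b\<in>Basis. \<Sum>d\<in>Basis. of_real ((d \<bullet> ?s b) * (c \<bullet> ?s b)) * ?D d c)"
    by (rule sum.swap)
  also have "\<dots> = (\<Sum>c\<in>Basis. \<Sum>d\<in>Basis. \<Sum>b\<in>Basis. of_real ((d \<bullet> ?s b) * (c \<bullet> ?s b)) * ?D d c)"
    by (intro sum.cong refl sum.swap)
  also have "\<dots> = (\<Sum>c\<in>Basis. \<Sum>d\<in>Basis. of_real (d \<bullet> c) * ?D d c)"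
    unfolding sum_distrib_right[symmetric] of_real_sum[symmetric] orth ..
  also have "\<dots> = (\<Sum>c\<in>Basis. \<Sum>d\<in>Basis. if d = c then ?D c c else 0)"
    by (intro sum.cong refl) (auto simp: inner_Basis)
  also have "\<dots> = laplacian f (?s x)" by (simp add: laplacian_def)
  finally show ?thesis .
qed

section \<open>The action of the group on its mirrors and their chosen normals\<close>

context
  fixes G :: "('a::euclidean_space \<Rightarrow> 'a) set" and A :: "'a set"
  assumes G: "coxeter_group G" and GA: "mirror_normals G A"
begin

lemma normal_nonzero: "\<alpha> \<in> A \<Longrightarrow> \<alpha> \<noteq> 0"
  using GA by (auto simp: mirror_normals_def)

lemma hyperplane_in_mirrors: "\<alpha> \<in> A \<Longrightarrow> hyperplane \<alpha> \<in> mirrors G"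
  using GA by (auto simp: mirror_normals_def bij_betw_def)

lemma hyperplane_inj: "\<alpha> \<in> A \<Longrightarrow> \<beta> \<in> A \<Longrightarrow> hyperplane \<alpha> = hyperplane \<beta> \<Longrightarrow> \<alpha> = \<beta>"
  using GA by (auto simp: mirror_normals_def bij_betw_def dest: inj_onD)

text \<open>Each mirror is the fixed point set of an element of the finite group G.\<close>

lemma finite_mirror_normals: "finite A"
proof -
  have "mirrors G \<subseteq> (\<lambda>g. {x. g x = x}) ` G"
    unfolding mirrors_def using reflection_fixed_points by blast
  then have "finite (mirrors G)"
    using G by (meson coxeter_group_def finite_imageI finite_subset)
  then show ?thesis using GA bij_betw_finite by (auto simp: mirror_normals_def)
qed

text \<open>\<open>mirrors\<close> only provides some normal \<beta> whose reflection lies in G. The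
  chosen normal is a nonzero multiple of it, and rescaling a normal leaves the reflection
  unchanged.\<close>

lemma reflection_in_group:
  assumes "\<alpha> \<in> A" shows "reflection \<alpha> \<in> G"
proof -
  obtain \<beta> where b: "hyperplane \<alpha> = hyperplane \<beta>" "\<beta> \<noteq> 0" "reflection \<beta> \<in> G"
    using hyperplane_in_mirrors[OF assms] by (auto simp: mirrors_def)
  obtain c where c: "\<alpha> = c *\<^sub>R \<beta>" using hyperplane_subset_imp_parallel[of \<beta> \<alpha>] b by blast
  then have "c \<noteq> 0" using normal_nonzero[OF assms] by auto
  then have "reflection \<alpha> = reflection \<beta>"
    by (auto simp: reflection_def c fun_eq_iff)
  then show ?thesis using b by simp
qed

lemma mirrors_reflection:
  assumes "\<alpha> \<in> A" "P \<in> mirrors G" shows "reflection \<alpha> ` P \<in> mirrors G"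
proof -
  have a: "\<alpha> \<noteq> 0" using normal_nonzero assms(1) .
  obtain \<beta> where b: "P = hyperplane \<beta>" "\<beta> \<noteq> 0" "reflection \<beta> \<in> G"
    using assms(2) by (auto simp: mirrors_def)
  have bij: "bij (reflection \<gamma>)" if "\<gamma> \<noteq> 0" for \<gamma> :: 'a
    using reflection_involution[OF that] by (intro involuntory_imp_bij) simp
  obtain R where R: "G = generate (BijGroup UNIV) (reflection ` R)"
    using G by (auto simp: coxeter_group_def)
  \<comment> \<open>The product of \<open>BijGroup UNIV\<close> is composition only on its carrier,
    hence the bijectivity premises.\<close>
  have comp: "g \<circ> h \<in> G" if "g \<in> G" "h \<in> G" "bij g" "bij h" for g h
  proof -
    have "g \<otimes>\<^bsub>BijGroup UNIV\<^esub> h \<in> G" using that R generate.eng by metis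
    then show ?thesis
      using that by (simp add: BijGroup_def Bij_def compose_def extensional_def o_def restrict_def)
  qed
  have "reflection \<alpha> \<circ> reflection \<beta> \<circ> reflection \<alpha> \<in> G"
    using reflection_in_group[OF assms(1)] b a by (intro comp bij bij_comp)
  then have "reflection (reflection \<alpha> \<beta>) \<in> G" using reflection_conjugate[OF a] by simp
  moreover have "reflection \<alpha> \<beta> \<noteq> 0"
    using reflection_inner[OF a, of \<beta> \<beta>] b(2) by auto
  ultimately show ?thesis
    unfolding mirrors_def b(1) reflection_hyperplane[OF a] by blast
qed

text \<open>The reflection permutes the mirrors, but the chosen normals only up to nonzero scalars.
  Every first order summand has degree 0 in its normal, so the scalars cancel, and m is constant
  along the permutation. On mirrors the identity persists because matching denominators vanish
  together and division by zero gives 0.\<close>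

lemma CM_operator_reflection:
  assumes m: "multiplicity_function G m" and f: "regular_on {} f" and a: "\<alpha> \<in> A"
  shows "CM_operator A m (\<lambda>x. f (reflection \<alpha> x)) x = CM_operator A m f (reflection \<alpha> x)"
    and "x \<in> regular_points A \<Longrightarrow> reflection \<alpha> x \<in> regular_points A"
proof -
  let ?s = "reflection \<alpha>"
  have a0: "\<alpha> \<noteq> 0" using a normal_nonzero by blast
  \<comment> \<open>The permutation of A induced by the reflection on mirrors; it is an involution,
    so it serves as its own inverse in the reindexing below.\<close>
  define \<tau> where "\<tau> \<beta> = inv_into A hyperplane (?s ` hyperplane \<beta>)" for \<beta>
  have surj: "hyperplane ` A = mirrors G" using GA by (auto simp: mirror_normals_def bij_betw_def)
  have tau: "\<tau> \<beta> \<in> A" "hyperplane (\<tau> \<beta>) = ?s ` hyperplane \<beta>" if "\<beta> \<in> A" for \<beta>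
    using mirrors_reflection[OF a hyperplane_in_mirrors[OF that]] surj
    by (simp_all add: \<tau>_def inv_into_into f_inv_into_f)
  have ss: "?s ` ?s ` P = P" for P
    using reflection_involution[OF a0] by (auto simp: image_image)
  have tt: "\<tau> (\<tau> \<beta>) = \<beta>" if "\<beta> \<in> A" for \<beta>
    using that tau[of \<beta>] tau[of "\<tau> \<beta>"] by (intro hyperplane_inj) (auto simp: ss)
  have par: "\<exists>c. c \<noteq> 0 \<and> \<tau> \<beta> = c *\<^sub>R ?s \<beta>" if b: "\<beta> \<in> A" for \<beta>
  proof -
    have h: "hyperplane (?s \<beta>) = hyperplane (\<tau> \<beta>)"
      using tau[OF b] reflection_hyperplane[OF a0] by simp
    have "?s \<beta> \<noteq> 0"
      using reflection_inner[OF a0, of \<beta> \<beta>] normal_nonzero[OF b] by auto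
    then obtain c where c: "\<tau> \<beta> = c *\<^sub>R ?s \<beta>" using hyperplane_subset_imp_parallel h by blast
    moreover have "c \<noteq> 0" using normal_nonzero[OF tau(1)[OF b]] c by auto
    ultimately show ?thesis by blast
  qed
  show "?s x \<in> regular_points A" if x: "x \<in> regular_points A"
  proof -
    have "\<beta> \<bullet> ?s x \<noteq> 0" if b: "\<beta> \<in> A" for \<beta>
    proof -
      obtain c where c: "c \<noteq> 0" "\<tau> \<beta> = c *\<^sub>R ?s \<beta>" using par[OF b] by blast
      have "\<tau> \<beta> \<bullet> x \<noteq> 0" using x tau(1)[OF b] by (auto simp: regular_points_def)
      then show ?thesis using c by (simp add: reflection_self_adjoint)
    qed
    then show ?thesis by (simp add: regular_points_def)
  qed
  let ?c = "\<lambda>\<beta>. complex_of_nat (2 * m (hyperplane \<beta>))"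
  have "(\<Sum>\<beta>\<in>A. ?c \<beta> / of_real (\<beta> \<bullet> x) * dir_deriv \<beta> (\<lambda>x. f (?s x)) x)
    = (\<Sum>\<beta>\<in>A. ?c \<beta> / of_real (\<beta> \<bullet> ?s x) * dir_deriv \<beta> f (?s x))"
  proof (rule sum.reindex_bij_witness[where i = \<tau> and j = \<tau>])
    fix \<beta> assume b: "\<beta> \<in> A"
    show "\<tau> (\<tau> \<beta>) = \<beta>" "\<tau> (\<tau> \<beta>) = \<beta>" "\<tau> \<beta> \<in> A" "\<tau> \<beta> \<in> A" using b tt tau by auto
    obtain c where c: "c \<noteq> 0" "\<tau> \<beta> = c *\<^sub>R ?s \<beta>" using par[OF b] by blast
    have "m (hyperplane (\<tau> \<beta>)) = m (hyperplane \<beta>)"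
      using m reflection_in_group[OF a] hyperplane_in_mirrors[OF b] tau(2)[OF b]
      by (simp add: multiplicity_function_def)
    moreover have "\<tau> \<beta> \<bullet> ?s x = c * (\<beta> \<bullet> x)"
      using c reflection_inner[OF a0] by simp
    moreover have "dir_deriv (\<tau> \<beta>) f (?s x) = c *\<^sub>R dir_deriv (?s \<beta>) f (?s x)"
      unfolding c using linear_scale[OF dir_deriv_linear[OF _ f, of "?s x"]] by simp
    ultimately show "?c (\<tau> \<beta>) / of_real (\<tau> \<beta> \<bullet> ?s x) * dir_deriv (\<tau> \<beta>) f (?s x)
      = ?c \<beta> / of_real (\<beta> \<bullet> x) * dir_deriv \<beta> (\<lambda>x. f (?s x)) x"
      using c(1) by (simp add: dir_deriv_reflection[OF f] scaleR_conv_of_real)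
  qed
  then show "CM_operator A m (\<lambda>x. f (?s x)) x = CM_operator A m f (?s x)"
    by (simp add: CM_operator_def laplacian_reflection[OF f a0] scaleR_conv_of_real)
qed

end

subsection \<open>Order of vanishing on a mirror\<close>

text \<open>Vanishing on the mirror is not inherited by summands or factors. The induction therefore
  treats arbitrary \<open>f\<close> and shows that \<open>f x - f (\<pi> x)\<close> is divisible by
  (\<alpha>,x), with \<pi> the orthogonal projection onto the mirror.\<close>

lemma polynomial_divide_linear:
  assumes "regular_on {} f" and a: "\<alpha> \<noteq> 0" and 0: "\<And>x. x \<in> hyperplane \<alpha> \<Longrightarrow> f x = 0"
  shows "\<exists>g. regular_on {} g \<and> f = (\<lambda>x. of_real (\<alpha> \<bullet> x) * g x)"
proof -
  define \<pi> where "\<pi> x = x - ((\<alpha> \<bullet> x) / (\<alpha> \<bullet> \<alpha>)) *\<^sub>R \<alpha>" for x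
  have "rational_expr {} f" using assms(1) by (simp add: regular_on_empty_iff)
  then have "\<exists>g. regular_on {} g \<and> (\<forall>x. f x = f (\<pi> x) + of_real (\<alpha> \<bullet> x) * g x)"
  proof induction
    case (const c)
    then show ?case by (intro exI[of _ "\<lambda>x. 0"]) (auto intro: regular_intros)
  next
    case (inner v)
    then show ?case
      by (intro exI[of _ "\<lambda>x. of_real ((v \<bullet> \<alpha>) / (\<alpha> \<bullet> \<alpha>))"])
        (auto intro: regular_on_const simp: \<pi>_def inner_diff_right)
  next
    case (add f g)
    then obtain f' g' where h: "regular_on {} f'" "regular_on {} g'"
      "\<And>x. f x = f (\<pi> x) + of_real (\<alpha> \<bullet> x) * f' x"
      "\<And>x. g x = g (\<pi> x) + of_real (\<alpha> \<bullet> x) * g' x" by blast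
    have "f x + g x = f (\<pi> x) + g (\<pi> x) + of_real (\<alpha> \<bullet> x) * (f' x + g' x)" for x
      by (subst h(3), subst h(4)) (simp add: algebra_simps)
    then show ?case using regular_on_add[OF h(1,2)] by blast
  next
    case (mult f g)
    then obtain f' g' where h: "regular_on {} f'" "regular_on {} g'"
      "\<And>x. f x = f (\<pi> x) + of_real (\<alpha> \<bullet> x) * f' x"
      "\<And>x. g x = g (\<pi> x) + of_real (\<alpha> \<bullet> x) * g' x" by blast
    \<comment> \<open>The natural cofactor is \<open>f x * g' x + f' x * g (\<pi> x)\<close>;
      eliminating \<open>g (\<pi> x)\<close> keeps it within functions already known to be
      regular.\<close>
    have "f x * g x = f (\<pi> x) * g (\<pi> x)
      + of_real (\<alpha> \<bullet> x) * (f x * g' x + f' x * (g x - of_real (\<alpha> \<bullet> x) * g' x))" for x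
    proof -
      have "g (\<pi> x) = g x - of_real (\<alpha> \<bullet> x) * g' x" "f (\<pi> x) = f x - of_real (\<alpha> \<bullet> x) * f' x"
        using h(3)[of x] h(4)[of x] by simp_all
      then show ?thesis by (simp only:) (simp add: algebra_simps)
    qed
    moreover have "regular_on {} (\<lambda>x. f x * g' x + f' x * (g x - of_real (\<alpha> \<bullet> x) * g' x))"
      using mult.hyps h(1,2) by (intro regular_intros) (simp_all add: regular_on_empty_iff)
    ultimately show ?case by blast
  qed simp
  then obtain g where g: "regular_on {} g" "\<And>x. f x = f (\<pi> x) + of_real (\<alpha> \<bullet> x) * g x" by blast
  have f0: "f (\<pi> x) = 0" for x
    using a by (intro 0) (simp add: hyperplane_def \<pi>_def inner_diff_right)
  have "f x = of_real (\<alpha> \<bullet> x) * g x" for x using g(2)[of x] f0[of x] by simp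
  then show ?thesis using g(1) by blast
qed

section \<open>Propagation of zeros by continuity\<close>

lemma isCont_zero_along_line:
  fixes F :: "'a::euclidean_space \<Rightarrow> complex"
  assumes "isCont F x" "open U" "x \<in> U"
    and "\<And>e. e \<noteq> 0 \<Longrightarrow> x + e *\<^sub>R v \<in> U \<Longrightarrow> F (x + e *\<^sub>R v) = 0"
  shows "F x = 0"
proof -
  have l: "((\<lambda>e. x + e *\<^sub>R v) \<longlongrightarrow> x) (at 0)"
    by (rule tendsto_eq_intros refl | simp)+
  then have "((\<lambda>e. F (x + e *\<^sub>R v)) \<longlongrightarrow> F x) (at 0)"
    using assms(1) isCont_tendsto_compose by blast
  moreover have "eventually (\<lambda>e. x + e *\<^sub>R v \<in> U) (at 0)"
    using l assms(2,3) topological_tendstoD by fast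
  then have "eventually (\<lambda>e. F (x + e *\<^sub>R v) = 0) (at 0)"
    using eventually_neq_at_within[of 0 0 UNIV]
    by eventually_elim (use assms(4) in auto)
  then have "((\<lambda>e. F (x + e *\<^sub>R v)) \<longlongrightarrow> 0) (at 0)"
    by (rule tendsto_eventually)
  ultimately show ?thesis
    using tendsto_unique trivial_limit_at by blast
qed

text \<open>A subspace contained in none of finitely many hyperplanes has a dense set of points off
  all of them. The hyperplanes are removed one at a time: a point on \<beta> but off the others is a
  limit of its translates by small multiples of a vector \<open>v\<close> of \<open>W\<close> with
  (\<beta>,v) nonzero, which leave \<beta> and stay off the others.\<close>

lemma zero_on_subspace:
  fixes g :: "'a::euclidean_space \<Rightarrow> complex"
  assumes "finite B" "subspace W" and "\<And>x. isCont g x"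
    and "\<And>\<beta>. \<beta> \<in> B \<Longrightarrow> \<exists>v\<in>W. \<beta> \<bullet> v \<noteq> 0"
    and "\<And>x. x \<in> W \<Longrightarrow> x \<in> regular_points B \<Longrightarrow> g x = 0"
    and "x \<in> W"
  shows "g x = 0"
  using assms(1,4-6)
proof (induction arbitrary: x rule: finite_induct)
  case empty
  then show ?case by simp
next
  case (insert \<beta> B)
  show ?case
  proof (rule insert.IH)
    fix y assume y: "y \<in> W" "y \<in> regular_points B"
    obtain v where v: "v \<in> W" "\<beta> \<bullet> v \<noteq> 0" using insert.prems(1) by blast
    show "g y = 0"
    proof (cases "\<beta> \<bullet> y = 0")
      case False
      then show ?thesis using y by (intro insert.prems(2)) (auto simp: regular_points_def)
    next
      case True
      show ?thesis
      proof (rule isCont_zero_along_line[OF assms(3) open_regular_points[OF insert.hyps(1)] y(2)])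
        fix e :: real
        assume e: "e \<noteq> 0" "y + e *\<^sub>R v \<in> regular_points B"
        show "g (y + e *\<^sub>R v) = 0"
        proof (rule insert.prems(2))
          show "y + e *\<^sub>R v \<in> W" using y v assms(2) by (simp add: subspace_add subspace_scale)
          show "y + e *\<^sub>R v \<in> regular_points (insert \<beta> B)"
            using e v True by (auto simp: regular_points_def inner_add_right)
        qed
      qed
    qed
  qed (use insert.prems in auto)
qed

lemma dir_deriv_linear_power:
  "dir_deriv v (\<lambda>x. of_real (\<alpha> \<bullet> x) ^ Suc j) =
    (\<lambda>x. of_nat (Suc j) * of_real (\<alpha> \<bullet> v) * of_real (\<alpha> \<bullet> x) ^ j)"
proof (rule ext, rule dir_deriv_eqI)
  fix x
  have "((\<lambda>x. complex_of_real (\<alpha> \<bullet> x)) has_derivative (\<lambda>v. of_real (\<alpha> \<bullet> v))) (at x)"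
    by (auto intro!: derivative_eq_intros)
  from has_derivative_power[OF this, of "Suc j"]
  show "((\<lambda>x. complex_of_real (\<alpha> \<bullet> x) ^ Suc j) has_derivative
    (\<lambda>v. of_nat (Suc j) * of_real (\<alpha> \<bullet> v) * of_real (\<alpha> \<bullet> x) ^ j)) (at x)"
    by (simp del: power_Suc of_nat_Suc)
qed

lemma dir_deriv_iterate_linear_power:
  assumes "regular_on {} g" "s \<le> n"
  shows "\<exists>h. regular_on {} h \<and> (dir_deriv \<alpha> ^^ s) (\<lambda>x. of_real (\<alpha> \<bullet> x) ^ n * g x)
    = (\<lambda>x. of_real (\<alpha> \<bullet> x) ^ (n - s) * h x)"
  using assms(2)
proof (induction s)
  case 0
  then show ?case using assms(1) by auto
next
  case (Suc s)
  then obtain h where h: "regular_on {} h" "(dir_deriv \<alpha> ^^ s) (\<lambda>x. of_real (\<alpha> \<bullet> x) ^ n * g x)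
    = (\<lambda>x. of_real (\<alpha> \<bullet> x) ^ (n - s) * h x)" by auto
  define k where "k = n - Suc s"
  have k: "n - s = Suc k" using Suc.prems by (simp add: k_def)
  have "dir_deriv \<alpha> (\<lambda>x. of_real (\<alpha> \<bullet> x) ^ Suc k * h x) x = of_real (\<alpha> \<bullet> x) ^ k *
    (of_real (\<alpha> \<bullet> x) * dir_deriv \<alpha> h x + of_nat (Suc k) * of_real (\<alpha> \<bullet> \<alpha>) * h x)" for x
    by (subst dir_deriv_mult[of "{}"], use h(1) in \<open>auto intro: regular_intros simp del: power_Suc\<close>)
      (simp add: dir_deriv_linear_power del: power_Suc, simp add: algebra_simps)
  moreover have "regular_on {}
    (\<lambda>x. of_real (\<alpha> \<bullet> x) * dir_deriv \<alpha> h x + of_nat (Suc k) * of_real (\<alpha> \<bullet> \<alpha>) * h x)"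
    using h(1) by (intro regular_intros) auto
  ultimately show ?case unfolding funpow.simps o_def h(2) k k_def[symmetric] by blast
qed

text \<open>The leading coefficient along the mirror of \<open>\<L>(t\<^sup>j\<^sup>+\<^sup>1 g)\<close>, where \<open>t = (\<alpha>,x)\<close>, is
  \<open>(j + 1) (j - 2m\<^sub>\<alpha>) (\<alpha>,\<alpha>) g\<close>: the exponents of \<open>\<L>\<close> at the mirror are \<open>0\<close> and \<open>2m\<^sub>\<alpha> + 1\<close>.\<close>

lemma CM_operator_indicial:
  assumes A: "finite A" and a: "\<alpha> \<in> A" "\<alpha> \<noteq> 0" and g: "regular_on {} g"
    and L: "\<And>x. x \<in> regular_points A \<Longrightarrow>
      CM_operator A m (\<lambda>x. of_real (\<alpha> \<bullet> x) ^ Suc j * g x) x = 0"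
    and j: "j \<noteq> 2 * m (hyperplane \<alpha>)"
    and x0: "x0 \<in> hyperplane \<alpha>" "x0 \<in> regular_points (A - {\<alpha>})"
  shows "g x0 = 0"
proof -
  let ?c = "coupling m" and ?t = "\<lambda>x. complex_of_real (\<alpha> \<bullet> x)"
  let ?B = "A - {\<alpha>}"
  \<comment> \<open>At regular points t L(t^(j+1) g) = t^j F with F = K g + t R; the sums
    \<open>P\<close> and \<open>Q\<close> collect the terms of the other mirrors. F has poles only
    on those, so it is continuous at \<open>x0\<close>, where t = 0 leaves K g.\<close>
  define K where "K = of_nat (Suc j) * (of_nat j - ?c \<alpha>) * complex_of_real (\<alpha> \<bullet> \<alpha>)"
  define P where "P x = (\<Sum>\<beta>\<in>?B. ?c \<beta> / of_real (\<beta> \<bullet> x) * dir_deriv \<beta> g x)" for x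
  define Q where "Q x = (\<Sum>\<beta>\<in>?B. ?c \<beta> / of_real (\<beta> \<bullet> x) * of_real (\<alpha> \<bullet> \<beta>))" for x
  define R where "R x = ?t x * (laplacian g x - P x)
    + (2 * of_nat (Suc j) - ?c \<alpha>) * dir_deriv \<alpha> g x - of_nat (Suc j) * g x * Q x" for x
  define F where "F x = K * g x + ?t x * R x" for x
  have B: "finite ?B" using A by simp
  have gA: "regular_on A g" and gB: "regular_on ?B g" using g regular_on_mono by blast+
  have "regular_on ?B P" "regular_on ?B Q"
    unfolding P_def[abs_def] Q_def[abs_def] using gB B by (intro regular_intros; simp)+
  then have "regular_on ?B F"
    unfolding F_def[abs_def] R_def[abs_def] by (intro regular_intros gB B)
  then have cont: "isCont F x0" using B x0(2) regular_on_continuous by blast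
  have F0: "F x = 0" if x: "x \<in> regular_points A" for x
  proof -
    have t: "?t x \<noteq> 0" using x a by (auto simp: regular_points_def)
    have S: "(\<Sum>\<beta>\<in>A. ?c \<beta> / of_real (\<beta> \<bullet> x) * u \<beta>) =
      ?c \<alpha> / ?t x * u \<alpha> + (\<Sum>\<beta>\<in>?B. ?c \<beta> / of_real (\<beta> \<bullet> x) * u \<beta>)" for u
      using A a(1) by (rule sum.remove)
    have Lg: "CM_operator A m g x = laplacian g x - ?c \<alpha> / ?t x * dir_deriv \<alpha> g x - P x"
      unfolding CM_operator_eq S P_def by simp
    \<comment> \<open>The quotient \<open>?t x ^ j / ?t x\<close> stands for the power j - 1, which
      natural numbers would truncate at j = 0; there the factor \<open>of_nat j\<close> makes the
      term zero.\<close>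
    have lap: "laplacian (\<lambda>x. ?t x ^ Suc j) x =
      of_nat (Suc j) * of_nat j * of_real (\<alpha> \<bullet> \<alpha>) * ?t x ^ j / ?t x"
    proof (cases j)
      case 0
      then show ?thesis
        unfolding laplacian_def dir_deriv_linear_power by (simp add: dir_deriv_const[abs_def])
    next
      case (Suc i)
      have "dir_deriv b (\<lambda>x. of_nat (Suc j) * of_real (\<alpha> \<bullet> b) * ?t x ^ j) x =
        of_nat (Suc j) * of_nat j * ?t x ^ i * of_real ((\<alpha> \<bullet> b) * (\<alpha> \<bullet> b))" for b
        unfolding Suc
        by (subst dir_deriv_mult[of "{}"])
          (auto simp: dir_deriv_linear_power intro: regular_intros simp del: power_Suc of_nat_Suc)
      then have "laplacian (\<lambda>x. ?t x ^ Suc j) x =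
        of_nat (Suc j) * of_nat j * ?t x ^ i * of_real (\<Sum>b\<in>Basis. (\<alpha> \<bullet> b) * (\<alpha> \<bullet> b))"
        unfolding laplacian_def dir_deriv_linear_power of_real_sum by (simp only: sum_distrib_left)
      then show ?thesis using t unfolding sum_Basis_inner by (simp add: Suc)
    qed
    have "(\<Sum>\<beta>\<in>?B. ?c \<beta> / of_real (\<beta> \<bullet> x) * (of_nat (Suc j) * of_real (\<alpha> \<bullet> \<beta>) * ?t x ^ j))
      = of_nat (Suc j) * ?t x ^ j * Q x"
      unfolding Q_def sum_distrib_left by (rule sum.cong) (simp_all add: mult_ac)
    then have Lt: "CM_operator A m (\<lambda>x. ?t x ^ Suc j) x =
      of_nat (Suc j) * of_nat j * of_real (\<alpha> \<bullet> \<alpha>) * ?t x ^ j / ?t x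
      - ?c \<alpha> / ?t x * (of_nat (Suc j) * of_real (\<alpha> \<bullet> \<alpha>) * ?t x ^ j) - of_nat (Suc j) * ?t x ^ j * Q x"
      unfolding CM_operator_eq S lap by (simp only: dir_deriv_linear_power diff_diff_eq)
    have G: "(\<Sum>b\<in>Basis. dir_deriv b (\<lambda>x. ?t x ^ Suc j) x * dir_deriv b g x)
      = of_nat (Suc j) * ?t x ^ j * dir_deriv \<alpha> g x"
      unfolding dir_deriv_linear_power dir_deriv_expand[OF A gA x, of \<alpha>] sum_distrib_left
      by (rule sum.cong) (simp_all add: mult_ac inner_commute)
    have "0 = ?t x ^ Suc j * CM_operator A m g x + g x * CM_operator A m (\<lambda>x. ?t x ^ Suc j) x
      + 2 * (\<Sum>b\<in>Basis. dir_deriv b (\<lambda>x. ?t x ^ Suc j) x * dir_deriv b g x)"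
      using L[OF x] unfolding CM_operator_mult[OF A regular_on_power[OF regular_on_inner] gA x]
      by (rule sym)
    then have "0 = ?t x * (?t x ^ Suc j * CM_operator A m g x
      + g x * CM_operator A m (\<lambda>x. ?t x ^ Suc j) x
      + 2 * (of_nat (Suc j) * ?t x ^ j * dir_deriv \<alpha> g x))"
      unfolding G by simp
    also have "\<dots> = ?t x ^ j * F x"
      unfolding Lg Lt F_def K_def R_def using t by (simp add: field_simps del: of_nat_Suc)
    finally show ?thesis using t by simp
  qed
  \<comment> \<open>Displacement along the normal \<alpha> leaves its mirror for every nonzero
    \<open>e\<close>, so \<open>x0\<close> is a limit of regular points, where F is zero.\<close>
  have "F x0 = 0"
  proof (rule isCont_zero_along_line[OF cont open_regular_points[OF B] x0(2)])
    fix e :: real assume "e \<noteq> 0" "x0 + e *\<^sub>R \<alpha> \<in> regular_points ?B"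
    then have "x0 + e *\<^sub>R \<alpha> \<in> regular_points A"
      using x0(1) a by (auto simp: regular_points_def hyperplane_def inner_add_right)
    then show "F (x0 + e *\<^sub>R \<alpha>) = 0" by (rule F0)
  qed
  moreover have "K \<noteq> 0"
  proof -
    have "of_nat j \<noteq> ?c \<alpha>" using j of_nat_eq_iff unfolding coupling_def by blast
    then show ?thesis using a(2) by (simp add: K_def del: of_nat_Suc)
  qed
  ultimately show ?thesis using x0(1) by (simp add: F_def hyperplane_def)
qed

lemma dir_deriv_iterate_regular:
  "regular_on {} f \<Longrightarrow> regular_on {} ((dir_deriv v ^^ s) f)"
  by (induction s) (auto intro: regular_intros)

lemma dir_deriv_iterate_diff:
  assumes "regular_on {} f" "regular_on {} g"
  shows "(dir_deriv v ^^ s) (\<lambda>x. f x - g x) = (\<lambda>x. (dir_deriv v ^^ s) f x - (dir_deriv v ^^ s) g x)"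
proof (induction s)
  case (Suc s)
  show ?case
    unfolding funpow.simps o_def Suc
    using assms dir_deriv_diff[of "{}" "(dir_deriv v ^^ s) f" "(dir_deriv v ^^ s) g"]
    by (simp add: dir_deriv_iterate_regular)
qed simp

text \<open>The reflection reverses \<alpha>, so each derivative contributes a sign. On the mirror,
  whose points are fixed, odd normal derivatives of \<open>f\<close> and of its reflected copy are
  therefore opposite.\<close>

lemma dir_deriv_iterate_reflection:
  assumes f: "regular_on {} f" and a: "\<alpha> \<noteq> 0"
  shows "(dir_deriv \<alpha> ^^ s) (\<lambda>x. f (reflection \<alpha> x)) =
    (\<lambda>x. (- 1) ^ s * (dir_deriv \<alpha> ^^ s) f (reflection \<alpha> x))"
proof (induction s)
  case (Suc s)
  let ?f = "(dir_deriv \<alpha> ^^ s) f"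
  have r: "regular_on {} ?f" using f dir_deriv_iterate_regular by blast
  have "dir_deriv \<alpha> (\<lambda>x. (- 1) ^ s * ?f (reflection \<alpha> x)) x =
    (- 1) ^ s * dir_deriv (- \<alpha>) ?f (reflection \<alpha> x)" for x
    using regular_on_reflection[OF r, of \<alpha>]
    by (subst dir_deriv_mult[of "{}"])
      (auto intro: regular_on_const simp: dir_deriv_reflection[OF r] reflection_normal[OF a])
  moreover have "dir_deriv (- \<alpha>) ?f y = - dir_deriv \<alpha> ?f y" for y
    using linear_neg[OF dir_deriv_linear[OF _ r, of y]] by simp
  ultimately show ?case unfolding funpow.simps o_def Suc by simp
qed simp

theorem theorem5:
  fixes G :: "('a::euclidean_space \<Rightarrow> 'a) set"
    and A :: "'a set"
    and m :: "'a set \<Rightarrow> nat"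
    and \<sigma> :: "nat \<Rightarrow> 'a \<Rightarrow> complex"
    and deg :: "nat \<Rightarrow> nat"
  assumes "coxeter_group G"
    and "mirror_normals G A"
    and "multiplicity_function G m"
    and "basic_invariants G \<sigma> deg"
  shows "harmonics A m \<sigma> deg \<subseteq> quasiinvariants A m"
proof
  fix \<psi> assume psi: "\<psi> \<in> harmonics A m \<sigma> deg"
  then have poly: "polynomial_function \<psi>" by (simp add: harmonics_def)
  then have reg: "regular_on {} \<psi>" by (rule polynomial_function_regular_on)
  note GA = assms(1,2)
  note A = finite_mirror_normals[OF GA]
  have "(dir_deriv \<alpha> ^^ s) \<psi> x0 = 0"
    if a: "\<alpha> \<in> A" and s: "odd s" "s < 2 * m (hyperplane \<alpha>)" and x0: "x0 \<in> hyperplane \<alpha>" for \<alpha> s x0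
  proof -
    let ?s = "reflection \<alpha>"
    have a0: "\<alpha> \<noteq> 0" using normal_nonzero[OF GA a] .
    have fixed: "?s x = x" if "x \<in> hyperplane \<alpha>" for x
      using that reflection_fixed_points[OF a0] by blast
    have one: "1 \<in> {1..DIM('a)}" using DIM_positive[where 'a='a] by (simp add: Suc_le_eq)
    \<comment> \<open>A nontrivial element of G activates the normalization of \<sigma> 1 in
      \<open>basic_invariants\<close>.\<close>
    have "?s \<noteq> id"
    proof
      assume "?s = id"
      then have "\<alpha> \<in> hyperplane \<alpha>" using reflection_fixed_points[OF a0] by auto
      then show False using a0 by (simp add: hyperplane_def)
    qed
    then have sigma: "\<sigma> 1 = (\<lambda>x. of_real (x \<bullet> x))"
      using reflection_in_group[OF GA a] assms(4) by (auto simp: basic_invariants_def)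
    have "homogeneous (deg 1) (\<sigma> 1)" using assms(4) one by (auto simp: basic_invariants_def)
    \<comment> \<open>Homogeneity at the scalar 2 and the nonzero vector \<alpha> gives 4 = 2^deg 1.
      This fixes the number of commutators and the prefactor in \<open>chi\<close>.\<close>
    then have "complex_of_real ((2 *\<^sub>R \<alpha>) \<bullet> (2 *\<^sub>R \<alpha>)) = 2 ^ deg 1 *\<^sub>R of_real (\<alpha> \<bullet> \<alpha>)"
      unfolding homogeneous_def sigma by blast
    then have "2 * (2 * (\<alpha> \<bullet> \<alpha>)) = 2 ^ deg 1 * (\<alpha> \<bullet> \<alpha>)"
      unfolding scaleR_conv_of_real of_real_mult[symmetric] of_real_eq_iff by simp
    then have "(2::real) ^ 2 = 2 ^ deg 1" using a0 by simp
    then have deg: "deg 1 = 2" by (subst (asm) power_inject_exp) auto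
    have L: "CM_operator A m \<psi> x = 0" if x: "x \<in> regular_points A" for x
    proof -
      have "chi A m (deg 1) (\<sigma> 1) \<psi> x = 0" using psi one x by (auto simp: harmonics_def)
      then show ?thesis unfolding deg sigma chi_norm_square[OF A reg x] .
    qed
    define \<phi> where "\<phi> x = \<psi> x - \<psi> (?s x)" for x
    have regs: "regular_on {} (\<lambda>x. \<psi> (?s x))" by (rule regular_on_reflection[OF reg])
    have phi: "regular_on {} \<phi>" unfolding \<phi>_def[abs_def] by (intro regular_intros reg regs)
    have Lphi: "CM_operator A m \<phi> x = 0" if x: "x \<in> regular_points A" for x
    proof -
      have r: "regular_on A (\<lambda>x. \<psi> (?s x))" "regular_on A \<psi>"
        using regs reg regular_on_mono by blast+
      have "CM_operator A m (\<lambda>x. \<psi> x + (- 1) * \<psi> (?s x)) x =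
        CM_operator A m \<psi> x + (- 1) * CM_operator A m (\<lambda>x. \<psi> (?s x)) x"
        by (simp only: CM_operator_add[OF A r(2) regular_on_mult[OF regular_on_const r(1)] x]
            CM_operator_cmult[OF A r(1) x])
      then show ?thesis
        using CM_operator_reflection[OF GA assms(3) reg a] x L by (simp add: \<phi>_def[abs_def])
    qed
    \<comment> \<open>Passing from j to j + 1 requires j < 2m, precisely where the indicial factor
      (j + 1)(j - 2m) is nonzero on this range; the last exponent reached is 2m + 1.\<close>
    have "\<exists>g. regular_on {} g \<and> \<phi> = (\<lambda>x. of_real (\<alpha> \<bullet> x) ^ Suc j * g x)"
      if "j \<le> 2 * m (hyperplane \<alpha>)" for j
      using that
    proof (induction j)
      case 0
      have "\<phi> x = 0" if "x \<in> hyperplane \<alpha>" for x using fixed[OF that] by (simp add: \<phi>_def)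
      then show ?case using polynomial_divide_linear[OF phi a0] by simp
    next
      case (Suc j)
      then obtain g where g: "regular_on {} g" "\<phi> = (\<lambda>x. of_real (\<alpha> \<bullet> x) ^ Suc j * g x)" by auto
      have "g x = 0" if x: "x \<in> hyperplane \<alpha>" for x
      proof (rule zero_on_subspace[of "A - {\<alpha>}" "hyperplane \<alpha>" g])
        show "subspace (hyperplane \<alpha>)" unfolding hyperplane_def by (rule subspace_hyperplane)
        show "isCont g y" for y using g(1) regular_on_continuous[of "{}" g y] by simp
        \<comment> \<open>Otherwise the two mirrors would coincide, although A contains one normal
          per mirror.\<close>
        show "\<exists>v\<in>hyperplane \<alpha>. \<beta> \<bullet> v \<noteq> 0" if b: "\<beta> \<in> A - {\<alpha>}" for \<beta>
        proof (rule ccontr)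
          assume "\<not> ?thesis"
          then have "hyperplane \<alpha> \<subseteq> hyperplane \<beta>" by (auto simp: hyperplane_def)
          then obtain c where c: "\<beta> = c *\<^sub>R \<alpha>" using hyperplane_subset_imp_parallel[OF a0] by blast
          moreover have "c \<noteq> 0" using c normal_nonzero[OF GA, of \<beta>] b by auto
          ultimately have "hyperplane \<beta> = hyperplane \<alpha>" by (auto simp: hyperplane_def)
          then show False using hyperplane_inj[OF GA, of \<beta> \<alpha>] a b by auto
        qed
        show "g y = 0" if "y \<in> hyperplane \<alpha>" "y \<in> regular_points (A - {\<alpha>})" for y
          using CM_operator_indicial[OF A a a0 g(1) _ _ that, of m j] Lphi Suc.prems
          unfolding g(2) by simp
      qed (use A x in auto)
      then obtain h where "regular_on {} h" "g = (\<lambda>x. of_real (\<alpha> \<bullet> x) * h x)"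
        using polynomial_divide_linear[OF g(1) a0] by blast
      then show ?case using g(2) by (intro exI[of _ h]) (simp add: mult_ac)
    qed
    then obtain g where g: "regular_on {} g" "\<phi> = (\<lambda>x. of_real (\<alpha> \<bullet> x) ^ Suc (2 * m (hyperplane \<alpha>)) * g x)"
      by blast
    obtain h where "(dir_deriv \<alpha> ^^ s) \<phi> = (\<lambda>x. of_real (\<alpha> \<bullet> x) ^ (Suc (2 * m (hyperplane \<alpha>)) - s) * h x)"
      using dir_deriv_iterate_linear_power[OF g(1), of s "Suc (2 * m (hyperplane \<alpha>))" \<alpha>] s(2)
      unfolding g(2) by auto
    \<comment> \<open>Since s < 2m, the remaining exponent of (\<alpha>,x) is positive.\<close>
    then have "(dir_deriv \<alpha> ^^ s) \<phi> x0 = 0" using x0 s(2) by (simp add: hyperplane_def)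
    moreover have "(dir_deriv \<alpha> ^^ s) \<phi> x0 = 2 * (dir_deriv \<alpha> ^^ s) \<psi> x0"
      unfolding \<phi>_def[abs_def] dir_deriv_iterate_diff[OF reg regs] dir_deriv_iterate_reflection[OF reg a0]
      using s(1) fixed[OF x0] by simp
    ultimately show ?thesis by simp
  qed
  then show "\<psi> \<in> quasiinvariants A m" using poly by (simp add: quasiinvariants_def)
qed

end
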